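(* $\mathsf{WSRRT}^2_2$ does not imply $\mathsf{RRT}^2_2$ over $\mathsf{RCA}_0$.
   Context: $\mathsf{RCA}_0$ is the usual base system of reverse mathematics (second-order arithmetic with $\Delta^0_1$-comprehension and $\Sigma^0_1$-induction). A coloring $f:[\mathbb{N}]^2\to\mathbb{N}$ (defined on pairs $x<s$) is 2-bounded if $|f^{-1}(y)|\le2$ for every $y$. A set $R$ is a rainbow for $f$ if $f$ is injective on $[R]^2$. $\mathsf{RRT}^2_2$ is the statement "every 2-bounded $f:[\mathbb{N}]^2\to\mathbb{N}$ has an infinite rainbow". The coloring $f$ is weakly rainbow-stable if for all $x,y$, either $f(x,s)=f(y,s)$ for all but finitely many $s$, or $f(x,s)\neq f(y,s)$ for all but finitely many $s$. $\mathsf{WSRRT}^2_2$ is the statement "every weakly rainbow-stable 2-bounded coloring $f:[\mathbb{N}]^2\to\mathbb{N}$ has an infinite rainbow". *)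

theory Defs
  imports Main
begin

section \<open>The language of second-order arithmetic\<close>

text \<open>Number variables and set variables are both named by strings, but they live in
  separate name spaces.  As usual for this language, equality is primitive only between
  numbers.\<close>

type_synonym name = string

datatype tm =
    Var name
  | Zero
  | One
  | Add tm tm  (infixl \<open>\<^bold>+\<close> 75)
  | Mul tm tm  (infixl \<open>\<^bold>*\<close> 80)

datatype fm =
    Eq tm tm  (infix \<open>\<^bold>=\<close> 70)
  | Less tm tm  (infix \<open>\<^bold><\<close> 70)
  | Mem tm name  (infix \<open>\<^bold>\<in>\<close> 70)
  | Bot  (\<open>\<^bold>\<bottom>\<close>)
  | Imp fm fm  (infixr \<open>\<^bold>\<rightarrow>\<close> 55)
  | AllN name fm
  | AllS name fm

abbreviation Neg :: "fm \<Rightarrow> fm" (\<open>\<^bold>\<not> _\<close> [65] 65)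
  where "\<^bold>\<not> \<phi> \<equiv> \<phi> \<^bold>\<rightarrow> \<^bold>\<bottom>"

abbreviation Con :: "fm \<Rightarrow> fm \<Rightarrow> fm" (infixr \<open>\<^bold>\<and>\<close> 63)
  where "\<phi> \<^bold>\<and> \<psi> \<equiv> \<^bold>\<not> (\<phi> \<^bold>\<rightarrow> \<^bold>\<not> \<psi>)"

abbreviation Dis :: "fm \<Rightarrow> fm \<Rightarrow> fm" (infixr \<open>\<^bold>\<or>\<close> 60)
  where "\<phi> \<^bold>\<or> \<psi> \<equiv> \<^bold>\<not> \<phi> \<^bold>\<rightarrow> \<psi>"

abbreviation Iff :: "fm \<Rightarrow> fm \<Rightarrow> fm" (infix \<open>\<^bold>\<leftrightarrow>\<close> 53)
  where "\<phi> \<^bold>\<leftrightarrow> \<psi> \<equiv> (\<phi> \<^bold>\<rightarrow> \<psi>) \<^bold>\<and> (\<psi> \<^bold>\<rightarrow> \<phi>)"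

abbreviation ExN :: "name \<Rightarrow> fm \<Rightarrow> fm"
  where "ExN x \<phi> \<equiv> \<^bold>\<not> (AllN x (\<^bold>\<not> \<phi>))"

abbreviation ExS :: "name \<Rightarrow> fm \<Rightarrow> fm"
  where "ExS X \<phi> \<equiv> \<^bold>\<not> (AllS X (\<^bold>\<not> \<phi>))"

abbreviation AllNs :: "name list \<Rightarrow> fm \<Rightarrow> fm"
  where "AllNs xs \<phi> \<equiv> foldr AllN xs \<phi>"

abbreviation ExNs :: "name list \<Rightarrow> fm \<Rightarrow> fm"
  where "ExNs xs \<phi> \<equiv> foldr ExN xs \<phi>"


subsection \<open>Free variables and substitution\<close>

primrec tvars :: "tm \<Rightarrow> name set" where
  "tvars (Var x) = {x}"
| "tvars Zero = {}"
| "tvars One = {}"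
| "tvars (s \<^bold>+ t) = tvars s \<union> tvars t"
| "tvars (s \<^bold>* t) = tvars s \<union> tvars t"

primrec fv :: "fm \<Rightarrow> name set" where
  "fv (s \<^bold>= t) = tvars s \<union> tvars t"
| "fv (s \<^bold>< t) = tvars s \<union> tvars t"
| "fv (t \<^bold>\<in> X) = tvars t"
| "fv \<^bold>\<bottom> = {}"
| "fv (\<phi> \<^bold>\<rightarrow> \<psi>) = fv \<phi> \<union> fv \<psi>"
| "fv (AllN x \<phi>) = fv \<phi> - {x}"
| "fv (AllS X \<phi>) = fv \<phi>"

primrec fvS :: "fm \<Rightarrow> name set" where
  "fvS (s \<^bold>= t) = {}"
| "fvS (s \<^bold>< t) = {}"
| "fvS (t \<^bold>\<in> X) = {X}"
| "fvS \<^bold>\<bottom> = {}"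
| "fvS (\<phi> \<^bold>\<rightarrow> \<psi>) = fvS \<phi> \<union> fvS \<psi>"
| "fvS (AllN x \<phi>) = fvS \<phi>"
| "fvS (AllS X \<phi>) = fvS \<phi> - {X}"

primrec tsubst :: "name \<Rightarrow> tm \<Rightarrow> tm \<Rightarrow> tm" where
  "tsubst x u (Var y) = (if y = x then u else Var y)"
| "tsubst x u Zero = Zero"
| "tsubst x u One = One"
| "tsubst x u (s \<^bold>+ t) = tsubst x u s \<^bold>+ tsubst x u t"
| "tsubst x u (s \<^bold>* t) = tsubst x u s \<^bold>* tsubst x u t"

text \<open>Substitution for the free occurrences of a variable does not rename bound variables;
  it is only meaningful under the corresponding \<open>free_for\<close> condition.\<close>

primrec subst :: "name \<Rightarrow> tm \<Rightarrow> fm \<Rightarrow> fm" where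
  "subst x u (s \<^bold>= t) = (tsubst x u s \<^bold>= tsubst x u t)"
| "subst x u (s \<^bold>< t) = (tsubst x u s \<^bold>< tsubst x u t)"
| "subst x u (t \<^bold>\<in> X) = (tsubst x u t \<^bold>\<in> X)"
| "subst x u \<^bold>\<bottom> = \<^bold>\<bottom>"
| "subst x u (\<phi> \<^bold>\<rightarrow> \<psi>) = (subst x u \<phi> \<^bold>\<rightarrow> subst x u \<psi>)"
| "subst x u (AllN y \<phi>) = AllN y (if y = x then \<phi> else subst x u \<phi>)"
| "subst x u (AllS Y \<phi>) = AllS Y (subst x u \<phi>)"

primrec substS :: "name \<Rightarrow> name \<Rightarrow> fm \<Rightarrow> fm" where
  "substS X U (s \<^bold>= t) = (s \<^bold>= t)"
| "substS X U (s \<^bold>< t) = (s \<^bold>< t)"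
| "substS X U (t \<^bold>\<in> Y) = (t \<^bold>\<in> (if Y = X then U else Y))"
| "substS X U \<^bold>\<bottom> = \<^bold>\<bottom>"
| "substS X U (\<phi> \<^bold>\<rightarrow> \<psi>) = (substS X U \<phi> \<^bold>\<rightarrow> substS X U \<psi>)"
| "substS X U (AllN y \<phi>) = AllN y (substS X U \<phi>)"
| "substS X U (AllS Y \<phi>) = AllS Y (if Y = X then \<phi> else substS X U \<phi>)"

primrec free_for :: "tm \<Rightarrow> name \<Rightarrow> fm \<Rightarrow> bool" where
  "free_for u x (s \<^bold>= t) = True"
| "free_for u x (s \<^bold>< t) = True"
| "free_for u x (t \<^bold>\<in> X) = True"
| "free_for u x \<^bold>\<bottom> = True"
| "free_for u x (\<phi> \<^bold>\<rightarrow> \<psi>) = (free_for u x \<phi> \<and> free_for u x \<psi>)"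
| "free_for u x (AllN y \<phi>) = (x \<notin> fv (AllN y \<phi>) \<or> y \<notin> tvars u \<and> free_for u x \<phi>)"
| "free_for u x (AllS Y \<phi>) = free_for u x \<phi>"

primrec free_forS :: "name \<Rightarrow> name \<Rightarrow> fm \<Rightarrow> bool" where
  "free_forS U X (s \<^bold>= t) = True"
| "free_forS U X (s \<^bold>< t) = True"
| "free_forS U X (t \<^bold>\<in> Y) = True"
| "free_forS U X \<^bold>\<bottom> = True"
| "free_forS U X (\<phi> \<^bold>\<rightarrow> \<psi>) = (free_forS U X \<phi> \<and> free_forS U X \<psi>)"
| "free_forS U X (AllN y \<phi>) = free_forS U X \<phi>"
| "free_forS U X (AllS Y \<phi>) = (X \<notin> fvS (AllS Y \<phi>) \<or> Y \<noteq> U \<and> free_forS U X \<phi>)"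


section \<open>Provability\<close>

text \<open>The Hilbert calculus of classical two-sorted first-order logic with equality (in the
  style of Mendelson).  Generalization is unrestricted, so the members of \<open>T\<close> stand for
  their universal closures; in particular, free variables in axiom schemes are parameters.\<close>

inductive provable :: "fm set \<Rightarrow> fm \<Rightarrow> bool" (infix \<open>\<turnstile>\<close> 50) for T :: "fm set" where
  Hyp: "\<phi> \<in> T \<Longrightarrow> T \<turnstile> \<phi>"
| Weak: "T \<turnstile> (\<phi> \<^bold>\<rightarrow> \<psi> \<^bold>\<rightarrow> \<phi>)"
| Distr: "T \<turnstile> ((\<phi> \<^bold>\<rightarrow> \<psi> \<^bold>\<rightarrow> \<chi>) \<^bold>\<rightarrow> (\<phi> \<^bold>\<rightarrow> \<psi>) \<^bold>\<rightarrow> \<phi> \<^bold>\<rightarrow> \<chi>)"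
| DNeg: "T \<turnstile> (\<^bold>\<not> (\<^bold>\<not> \<phi>) \<^bold>\<rightarrow> \<phi>)"
| MP: "T \<turnstile> (\<phi> \<^bold>\<rightarrow> \<psi>) \<Longrightarrow> T \<turnstile> \<phi> \<Longrightarrow> T \<turnstile> \<psi>"
| Inst: "free_for t x \<phi> \<Longrightarrow> T \<turnstile> (AllN x \<phi> \<^bold>\<rightarrow> subst x t \<phi>)"
| Shift: "x \<notin> fv \<phi> \<Longrightarrow> T \<turnstile> (AllN x (\<phi> \<^bold>\<rightarrow> \<psi>) \<^bold>\<rightarrow> \<phi> \<^bold>\<rightarrow> AllN x \<psi>)"
| Gen: "T \<turnstile> \<phi> \<Longrightarrow> T \<turnstile> AllN x \<phi>"
| InstS: "free_forS Y X \<phi> \<Longrightarrow> T \<turnstile> (AllS X \<phi> \<^bold>\<rightarrow> substS X Y \<phi>)"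
| ShiftS: "X \<notin> fvS \<phi> \<Longrightarrow> T \<turnstile> (AllS X (\<phi> \<^bold>\<rightarrow> \<psi>) \<^bold>\<rightarrow> \<phi> \<^bold>\<rightarrow> AllS X \<psi>)"
| GenS: "T \<turnstile> \<phi> \<Longrightarrow> T \<turnstile> AllS X \<phi>"
| Refl: "T \<turnstile> (t \<^bold>= t)"
| Leibniz: "free_for s x \<phi> \<Longrightarrow> free_for t x \<phi> \<Longrightarrow>
    T \<turnstile> (s \<^bold>= t \<^bold>\<rightarrow> subst x s \<phi> \<^bold>\<rightarrow> subst x t \<phi>)"


section \<open>The theory \<open>RCA\<^sub>0\<close>\<close>

inductive Delta00 :: "fm \<Rightarrow> bool" where
  "Delta00 (s \<^bold>= t)"
| "Delta00 (s \<^bold>< t)"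
| "Delta00 (t \<^bold>\<in> X)"
| "Delta00 \<^bold>\<bottom>"
| "Delta00 \<phi> \<Longrightarrow> Delta00 \<psi> \<Longrightarrow> Delta00 (\<phi> \<^bold>\<rightarrow> \<psi>)"
| "Delta00 \<phi> \<Longrightarrow> x \<notin> tvars t \<Longrightarrow> Delta00 (AllN x (Var x \<^bold>< t \<^bold>\<rightarrow> \<phi>))"
| "Delta00 \<phi> \<Longrightarrow> x \<notin> tvars t \<Longrightarrow> Delta00 (ExN x (Var x \<^bold>< t \<^bold>\<and> \<phi>))"

definition Sigma01 :: "fm set"
  where "Sigma01 = {ExN x \<theta> | x \<theta>. Delta00 \<theta>}"

definition Pi01 :: "fm set"
  where "Pi01 = {AllN x \<theta> | x \<theta>. Delta00 \<theta>}"

definition basic_axioms :: "fm set" where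
  "basic_axioms = (let m = Var ''m''; n = Var ''n'' in
    {\<^bold>\<not> (n \<^bold>+ One \<^bold>= Zero),
     m \<^bold>+ One \<^bold>= n \<^bold>+ One \<^bold>\<rightarrow> m \<^bold>= n,
     m \<^bold>+ Zero \<^bold>= m,
     m \<^bold>+ (n \<^bold>+ One) \<^bold>= (m \<^bold>+ n) \<^bold>+ One,
     m \<^bold>* Zero \<^bold>= Zero,
     m \<^bold>* (n \<^bold>+ One) \<^bold>= m \<^bold>* n \<^bold>+ m,
     \<^bold>\<not> (m \<^bold>< Zero),
     m \<^bold>< n \<^bold>+ One \<^bold>\<leftrightarrow> (m \<^bold>< n \<^bold>\<or> m \<^bold>= n)})"

text \<open>Neither \<open>Zero\<close> nor \<open>Var n \<^bold>+ One\<close> can be captured when substituted for \<open>n\<close>.\<close>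

definition Sigma01_induction :: "fm set" where
  "Sigma01_induction =
    {subst n Zero \<phi> \<^bold>\<and> AllN n (\<phi> \<^bold>\<rightarrow> subst n (Var n \<^bold>+ One) \<phi>) \<^bold>\<rightarrow> AllN n \<phi>
      | n \<phi>. \<phi> \<in> Sigma01}"

definition Delta01_comprehension :: "fm set" where
  "Delta01_comprehension =
    {AllN n (\<phi> \<^bold>\<leftrightarrow> \<psi>) \<^bold>\<rightarrow> ExS X (AllN n (Var n \<^bold>\<in> X \<^bold>\<leftrightarrow> \<phi>))
      | n \<phi> \<psi> X. \<phi> \<in> Sigma01 \<and> \<psi> \<in> Pi01 \<and> X \<notin> fvS \<phi>}"

definition RCA0 :: "fm set"
  where "RCA0 = basic_axioms \<union> Sigma01_induction \<union> Delta01_comprehension"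


section \<open>Rainbow Ramsey statements\<close>

text \<open>The usual pairing \<open>(i, j) = (i + j)\<^sup>2 + i\<close>, which is injective provably in \<open>RCA\<^sub>0\<close>.\<close>

definition pair :: "tm \<Rightarrow> tm \<Rightarrow> tm"
  where "pair s t = (s \<^bold>+ t) \<^bold>* (s \<^bold>+ t) \<^bold>+ s"

text \<open>A function is identified with the set of codes of its argument-value pairs;
  \<open>value_is F p c\<close> says that the colour of the pair with code \<open>p\<close> is \<open>c\<close>.\<close>

definition value_is :: "name \<Rightarrow> tm \<Rightarrow> tm \<Rightarrow> fm"
  where "value_is F p c = (pair p c \<^bold>\<in> F)"

definition is_colouring :: "name \<Rightarrow> fm" where
  "is_colouring F =
    (let x = Var ''x''; s = Var ''s''; c = Var ''c''; d = Var ''d''; z = Var ''z'' in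
      AllN ''z'' (z \<^bold>\<in> F \<^bold>\<rightarrow>
        ExNs [''x'', ''s'', ''c''] (x \<^bold>< s \<^bold>\<and> z \<^bold>= pair (pair x s) c)) \<^bold>\<and>
      AllNs [''x'', ''s''] (x \<^bold>< s \<^bold>\<rightarrow>
        ExN ''c'' (value_is F (pair x s) c \<^bold>\<and>
          AllN ''d'' (value_is F (pair x s) d \<^bold>\<rightarrow> d \<^bold>= c))))"

definition is_2_bounded :: "name \<Rightarrow> fm" where
  "is_2_bounded F =
    (let p = Var ''p''; q = Var ''q''; r = Var ''r''; c = Var ''c'' in
      AllNs [''c'', ''p'', ''q'', ''r'']
        (value_is F p c \<^bold>\<and> value_is F q c \<^bold>\<and> value_is F r c \<^bold>\<rightarrow>
          p \<^bold>= q \<^bold>\<or> p \<^bold>= r \<^bold>\<or> q \<^bold>= r))"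

definition is_infinite :: "name \<Rightarrow> fm" where
  "is_infinite R =
    (let m = Var ''m''; n = Var ''n'' in
      AllN ''n'' (ExN ''m'' (n \<^bold>< m \<^bold>\<and> m \<^bold>\<in> R)))"

definition is_rainbow :: "name \<Rightarrow> name \<Rightarrow> fm" where
  "is_rainbow F R =
    (let x = Var ''x''; s = Var ''s''; y = Var ''y''; t = Var ''t''; c = Var ''c'' in
      AllNs [''x'', ''s'', ''y'', ''t'', ''c'']
        (x \<^bold>\<in> R \<^bold>\<and> s \<^bold>\<in> R \<^bold>\<and> x \<^bold>< s \<^bold>\<and> y \<^bold>\<in> R \<^bold>\<and> t \<^bold>\<in> R \<^bold>\<and> y \<^bold>< t \<^bold>\<and>
          value_is F (pair x s) c \<^bold>\<and> value_is F (pair y t) c \<^bold>\<rightarrow>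
          x \<^bold>= y \<^bold>\<and> s \<^bold>= t))"

text \<open>Here \<open>f(x,s)\<close> and \<open>f(y,s)\<close> are only defined when \<open>s\<close> exceeds \<open>x\<close> and \<open>y\<close>, hence for
  all but finitely many \<open>s\<close>.\<close>

definition is_weakly_rainbow_stable :: "name \<Rightarrow> fm" where
  "is_weakly_rainbow_stable F =
    (let x = Var ''x''; y = Var ''y''; s = Var ''s''; b = Var ''b'';
         c = Var ''c''; d = Var ''d'' in
      AllNs [''x'', ''y'']
        (ExN ''b'' (AllN ''s'' (b \<^bold>< s \<^bold>\<rightarrow>
          ExN ''c'' (value_is F (pair x s) c \<^bold>\<and> value_is F (pair y s) c))) \<^bold>\<or>
         ExN ''b'' (AllN ''s'' (b \<^bold>< s \<^bold>\<rightarrow>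
          ExNs [''c'', ''d'']
            (value_is F (pair x s) c \<^bold>\<and> value_is F (pair y s) d \<^bold>\<and> \<^bold>\<not> (c \<^bold>= d))))))"

definition RRT22 :: fm where
  "RRT22 =
    AllS ''F'' (is_colouring ''F'' \<^bold>\<and> is_2_bounded ''F'' \<^bold>\<rightarrow>
      ExS ''R'' (is_infinite ''R'' \<^bold>\<and> is_rainbow ''F'' ''R''))"

definition WSRRT22 :: fm where
  "WSRRT22 =
    AllS ''F'' (is_colouring ''F'' \<^bold>\<and> is_2_bounded ''F'' \<^bold>\<and> is_weakly_rainbow_stable ''F'' \<^bold>\<rightarrow>
      ExS ''R'' (is_infinite ''R'' \<^bold>\<and> is_rainbow ''F'' ''R''))"

end

(* The model is an omega-model. Fix a countable family of functionals on Baire space that is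
closed under composition and contains every functional needed in the argument. Let P be below Q
if P is the value at Q of a member of the family that is continuous at Q, and let L be an oracle
listing, for all members of the family, which finite pieces of information force which values.
With L in place of a computable set this behaves like Turing reducibility, but showing that a
construction is effective only requires its local constancy. The sets of the model are those
below some member of an increasing sequence of oracles X above L that are low, in the sense that
the jump of X is below the jump of L.

RRT fails: from limit-computable guesses at all sets R below the jump of L, a colouring f below L
matches, at each stage s and for each index e < s, two of the first 2e + 2 elements guessed to be
in R, and puts f(x,s) = f(y,s) for matched x, y.

WSRRT holds: for a weakly rainbow-stable f below a low X, the relation "f(x,s) = f(y,s) for almost
all s" is below the jump of X and has classes with at most two elements. Forcing with bushy trees
gives a sequence G of pairwise inequivalent numbers such that X joined with G is low: the
inequivalence requirement excludes boundedly many children of each node, so it cannot empty a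
bushy tree, and whether there is a bushy tree of strings that answer a query positively is decided
by the jump of X. The range of G is thinned out to a rainbow greedily. *)

theory Submission
  imports Defs "HOL-Library.Countable" "HOL-Library.Sublist"
begin

section \<open>Semantics over the standard numbers\<close>

primrec tval :: "(name \<Rightarrow> nat) \<Rightarrow> tm \<Rightarrow> nat" where
  "tval v (Var x) = v x"
| "tval v Zero = 0"
| "tval v One = 1"
| "tval v (s \<^bold>+ t) = tval v s + tval v t"
| "tval v (s \<^bold>* t) = tval v s * tval v t"

primrec sat :: "nat set set \<Rightarrow> (name \<Rightarrow> nat) \<Rightarrow> (name \<Rightarrow> nat set) \<Rightarrow> fm \<Rightarrow> bool" where
  "sat M v E (s \<^bold>= t) = (tval v s = tval v t)"
| "sat M v E (s \<^bold>< t) = (tval v s < tval v t)"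
| "sat M v E (t \<^bold>\<in> X) = (tval v t \<in> E X)"
| "sat M v E \<^bold>\<bottom> = False"
| "sat M v E (\<phi> \<^bold>\<rightarrow> \<psi>) = (sat M v E \<phi> \<longrightarrow> sat M v E \<psi>)"
| "sat M v E (AllN x \<phi>) = (\<forall>a. sat M (v(x := a)) E \<phi>)"
| "sat M v E (AllS X \<phi>) = (\<forall>A\<in>M. sat M v (E(X := A)) \<phi>)"

section \<open>Substitution and soundness of the calculus\<close>

lemma tval_cong: "(\<And>x. x \<in> tvars t \<Longrightarrow> v x = w x) \<Longrightarrow> tval v t = tval w t"
  by (induction t) auto

lemma sat_cong:
  "(\<And>x. x \<in> fv \<phi> \<Longrightarrow> v x = w x) \<Longrightarrow> (\<And>X. X \<in> fvS \<phi> \<Longrightarrow> E X = E' X) \<Longrightarrow>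
    sat M v E \<phi> = sat M w E' \<phi>"
proof (induction \<phi> arbitrary: v w E E')
  case (Eq s t)
  then show ?case using tval_cong[of s v w] tval_cong[of t v w] by auto
next
  case (Less s t)
  then show ?case using tval_cong[of s v w] tval_cong[of t v w] by auto
next
  case (Mem t X)
  then show ?case using tval_cong[of t v w] by auto
next
  case (Imp \<phi> \<psi>)
  have "sat M v E \<phi> = sat M w E' \<phi>" "sat M v E \<psi> = sat M w E' \<psi>"
    using Imp.prems by (auto intro!: Imp.IH)
  then show ?case by simp
next
  case (AllN x \<phi>)
  have "sat M (v(x := a)) E \<phi> = sat M (w(x := a)) E' \<phi>" for a
    using AllN.prems by (auto intro!: AllN.IH)
  then show ?case by simp
next
  case (AllS X \<phi>)
  have "sat M v (E(X := A)) \<phi> = sat M w (E'(X := A)) \<phi>" for A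
    using AllS.prems by (auto intro!: AllS.IH)
  then show ?case by simp
qed simp

lemma tval_tsubst: "tval v (tsubst x u t) = tval (v(x := tval v u)) t"
  by (induction t) auto

lemma tsubst_notin: "x \<notin> tvars t \<Longrightarrow> tsubst x u t = t"
  by (induction t) auto

lemma subst_notin: "x \<notin> fv \<phi> \<Longrightarrow> subst x u \<phi> = \<phi>"
  by (induction \<phi>) (auto simp: tsubst_notin)

lemma substS_notin: "X \<notin> fvS \<phi> \<Longrightarrow> substS X U \<phi> = \<phi>"
  by (induction \<phi>) auto

text \<open>When \<open>x\<close> is not free below the quantifier, \<open>free_for\<close> gives no
  protection against capture, but then the substitution is the identity. Otherwise the two updates
  of the assignment commute.\<close>

lemma sat_subst:
  "free_for u x \<phi> \<Longrightarrow> sat M v E (subst x u \<phi>) = sat M (v(x := tval v u)) E \<phi>"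
proof (induction \<phi> arbitrary: v E)
  case (AllN y \<phi>)
  show ?case
  proof (cases "x \<in> fv (AllN y \<phi>)")
    case False
    then have "subst x u (AllN y \<phi>) = AllN y \<phi>" by (rule subst_notin)
    then show ?thesis using False by (simp only: ) (rule sat_cong, auto)
  next
    case True
    with AllN have *: "y \<noteq> x" "y \<notin> tvars u" "free_for u x \<phi>" by auto
    have t: "tval (v(y := a)) u = tval v u" for a
      using * by (intro tval_cong) auto
    have "sat M (v(y := a)) E (subst x u \<phi>) = sat M (v(x := tval v u, y := a)) E \<phi>" for a
      using AllN.IH[OF *(3), of "v(y := a)" E] *(1) by (simp only: t fun_upd_twist[of x y])
    then show ?thesis using * by (simp only: subst.simps sat.simps if_False)
  qed
qed (auto simp: tval_tsubst)

lemma sat_substS: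
  "free_forS U X \<phi> \<Longrightarrow> sat M v E (substS X U \<phi>) = sat M v (E(X := E U)) \<phi>"
proof (induction \<phi> arbitrary: v E)
  case (AllS Y \<phi>)
  show ?case
  proof (cases "X \<in> fvS (AllS Y \<phi>)")
    case False
    then have "substS X U (AllS Y \<phi>) = AllS Y \<phi>" by (rule substS_notin)
    then show ?thesis using False by (simp only: ) (rule sat_cong, auto)
  next
    case True
    with AllS have *: "Y \<noteq> X" "Y \<noteq> U" "free_forS U X \<phi>" by auto
    have "sat M v (E(Y := A)) (substS X U \<phi>) = sat M v (E(X := E U, Y := A)) \<phi>" for A
      using AllS.IH[OF *(3), of v "E(Y := A)"] *(1,2)
      by (simp only: fun_upd_twist[of X Y] fun_upd_other)
    then show ?thesis using * by (simp only: substS.simps sat.simps if_False)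
  qed
qed auto

text \<open>Validity of \<open>T\<close> is assumed for every assignment into \<open>M\<close>,
  matching the unrestricted generalization rules. The assignment stays in \<open>M\<close> because
  universal set quantifiers are instantiated with its values.\<close>

theorem soundness:
  assumes "T \<turnstile> \<phi>"
    and "\<And>\<psi> v E. \<psi> \<in> T \<Longrightarrow> (\<And>X. E X \<in> M) \<Longrightarrow> sat M v E \<psi>"
    and "\<And>X. E X \<in> M"
  shows "sat M v E \<phi>"
  using assms(1) assms(3)
proof (induction arbitrary: v E)
  case (Shift x \<phi> \<psi>)
  have "sat M (v(x := a)) E \<phi> = sat M v E \<phi>" for a
    using Shift by (intro sat_cong) auto
  then show ?case by simp
next
  case (ShiftS X \<phi> \<psi>)
  have "sat M v (E(X := A)) \<phi> = sat M v E \<phi>" for A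
    using ShiftS by (intro sat_cong) auto
  then show ?case by simp
next
  case (Hyp \<phi>)
  then show ?case by (rule assms(2))
next
  case (Leibniz s x \<phi> t)
  then show ?case by (simp add: sat_subst)
next
  case (Inst t x \<phi>)
  then show ?case by (simp add: sat_subst)
next
  case (InstS Y X \<phi>)
  then have "E Y \<in> M" by simp
  then show ?case using InstS by (simp add: sat_substS)
next
  case (MP \<phi> \<psi>)
  show ?case using MP.IH[OF MP.prems] by simp
next
  case (GenS \<phi> X)
  have "sat M v (E(X := A)) \<phi>" if "A \<in> M" for A
    using GenS.prems that by (intro GenS.IH) auto
  then show ?case by simp
qed simp_all

text \<open>Bounded formulas contain no set quantifiers. This lets the functionals of the family
  evaluate them by \<open>sat {}\<close>, before any model is available.\<close>

lemma sat_Delta00: "Delta00 \<theta> \<Longrightarrow> sat M v E \<theta> = sat N v E \<theta>"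
  by (induction arbitrary: v rule: Delta00.induct) auto

lemma finite_tvars: "finite (tvars t)"
  by (induction t) auto

lemma finite_fv: "finite (fv \<phi>)"
  by (induction \<phi>) (auto simp: finite_tvars)

lemma finite_fvS: "finite (fvS \<phi>)"
  by (induction \<phi>) auto

lemma sat_basic_axioms: "\<phi> \<in> basic_axioms \<Longrightarrow> sat M v E \<phi>"
  by (auto simp: basic_axioms_def Let_def)

lemma free_for_Suc: "free_for (Var n \<^bold>+ One) n \<phi>"
  by (induction \<phi>) auto

lemma free_for_Zero: "free_for Zero n \<phi>"
  by (induction \<phi>) auto

text \<open>The numbers are standard, so the scheme reduces to induction on the value of
  \<open>n\<close> in the metatheory.\<close>

lemma sat_induction: "\<phi> \<in> Sigma01_induction \<Longrightarrow> sat M v E \<phi>"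
proof -
  assume "\<phi> \<in> Sigma01_induction"
  then obtain n \<psi> where \<phi>:
    "\<phi> = (subst n Zero \<psi> \<^bold>\<and> AllN n (\<psi> \<^bold>\<rightarrow> subst n (Var n \<^bold>+ One) \<psi>) \<^bold>\<rightarrow> AllN n \<psi>)"
    unfolding Sigma01_induction_def by blast
  have "\<forall>a. sat M (v(n := a)) E \<psi>"
    if "sat M (v(n := 0)) E \<psi>"
      and step: "\<forall>a. sat M (v(n := a)) E \<psi> \<longrightarrow> sat M (v(n := a + 1)) E \<psi>"
  proof
    show "sat M (v(n := a)) E \<psi>" for a
    proof (induction a)
      case (Suc a)
      with step have "sat M (v(n := a + 1)) E \<psi>" by blast
      then show ?case by (simp only: Suc_eq_plus1)
    qed fact
  qed
  then show ?thesis
    unfolding \<phi>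
    by (simp only: sat.simps sat_subst[OF free_for_Suc] sat_subst[OF free_for_Zero] tval.simps
        fun_upd_upd fun_upd_same simp_thms) blast
qed

section \<open>Local constancy on Baire space\<close>

type_synonym orc = "nat \<Rightarrow> nat"

definition agree :: "nat \<Rightarrow> orc \<Rightarrow> orc \<Rightarrow> bool" where
  "agree k P Q \<longleftrightarrow> (\<forall>i<k. Q i = P i)"

lemma agree_max: "agree (max k l) P Q \<longleftrightarrow> agree k P Q \<and> agree l P Q"
  unfolding agree_def less_max_iff_disj by blast

lemma agree_mono: "agree k P Q \<Longrightarrow> l \<le> k \<Longrightarrow> agree l P Q"
  unfolding agree_def by (meson order_less_le_trans)

lemma agree_refl [simp]: "agree k P P"
  by (simp add: agree_def)

text \<open>Continuity at \<open>P\<close> of a map from Baire space into a discrete space.\<close>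

definition loc :: "(orc \<Rightarrow> 'a) \<Rightarrow> orc \<Rightarrow> bool" where
  "loc \<phi> P \<longleftrightarrow> (\<exists>k. \<forall>Q. agree k P Q \<longrightarrow> \<phi> Q = \<phi> P)"

text \<open>Continuity is asked at a single point: the functionals below search with
  \<open>LEAST\<close>, and need to behave well only where the search succeeds.\<close>

definition cont :: "(orc \<Rightarrow> orc) \<Rightarrow> orc \<Rightarrow> bool" where
  "cont \<Theta> P \<longleftrightarrow> (\<forall>n. loc (\<lambda>Q. \<Theta> Q n) P)"

lemma loc_const: "loc (\<lambda>Q. c) P"
  by (simp add: loc_def)

lemma loc_app: "loc (\<lambda>Q. Q n) P"
  unfolding loc_def agree_def using lessI by blast

text \<open>Near \<open>P\<close> the first value is frozen at \<open>\<phi> P\<close>, so the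
  second computation is examined for that value alone. In this way staged constructions can exploit
  invariants that are known only at \<open>P\<close>.\<close>

lemma loc_bind:
  assumes "loc \<phi> P" "loc (\<psi> (\<phi> P)) P"
  shows "loc (\<lambda>Q. \<psi> (\<phi> Q) Q) P"
proof -
  obtain k l where k: "\<And>Q. agree k P Q \<Longrightarrow> \<phi> Q = \<phi> P"
    and l: "\<And>Q. agree l P Q \<Longrightarrow> \<psi> (\<phi> P) Q = \<psi> (\<phi> P) P"
    using assms unfolding loc_def by blast
  have "\<psi> (\<phi> Q) Q = \<psi> (\<phi> P) P" if "agree (max k l) P Q" for Q
  proof -
    have "agree k P Q" "agree l P Q" using that by (simp_all only: agree_max)
    from k[OF this(1)] l[OF this(2)] show ?thesis by argo
  qed
  then show ?thesis unfolding loc_def by blast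
qed

lemma loc_fun: "loc \<phi> P \<Longrightarrow> loc (\<lambda>Q. g (\<phi> Q)) P"
  unfolding loc_def by metis

lemma loc_fun2:
  assumes "loc \<phi> P" "loc \<psi> P"
  shows "loc (\<lambda>Q. g (\<phi> Q) (\<psi> Q)) P"
  using assms(1) loc_fun[OF assms(2)]
  by (rule loc_bind[where \<phi> = \<phi> and \<psi> = "\<lambda>x Q. g x (\<psi> Q)"])

lemma loc_at: "loc \<phi> P \<Longrightarrow> loc (\<lambda>Q. Q (\<phi> Q)) P"
  by (rule loc_bind[where \<phi> = \<phi> and \<psi> = "\<lambda>x Q. Q x", OF _ loc_app])

lemma loc_if:
  assumes "loc c P" "c P \<Longrightarrow> loc \<phi> P" "\<not> c P \<Longrightarrow> loc \<psi> P"
  shows "loc (\<lambda>Q. if c Q then \<phi> Q else \<psi> Q) P"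
proof -
  have "loc (\<lambda>Q. if c P then \<phi> Q else \<psi> Q) P"
    using assms(2,3) by (cases "c P") simp_all
  with assms(1) show ?thesis
    by (rule loc_bind[where \<phi> = c and \<psi> = "\<lambda>b Q. if b then \<phi> Q else \<psi> Q"])
qed

lemma loc_conj:
  assumes "loc c P" "c P \<Longrightarrow> loc d P"
  shows "loc (\<lambda>Q. c Q \<and> d Q) P"
proof -
  have "loc (\<lambda>Q. c P \<and> d Q) P"
    using assms(2) by (cases "c P") (simp_all add: loc_const)
  with assms(1) show ?thesis
    by (rule loc_bind[where \<phi> = c and \<psi> = "\<lambda>b Q. b \<and> d Q"])
qed

lemma loc_imp:
  assumes "loc c P" "c P \<Longrightarrow> loc d P"
  shows "loc (\<lambda>Q. c Q \<longrightarrow> d Q) P"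
proof -
  have "loc (\<lambda>Q. c P \<longrightarrow> d Q) P"
    using assms(2) by (cases "c P") (simp_all add: loc_const)
  with assms(1) show ?thesis
    by (rule loc_bind[where \<phi> = c and \<psi> = "\<lambda>b Q. b \<longrightarrow> d Q"])
qed

lemma loc_finite:
  assumes "finite A" "\<And>i. i \<in> A \<Longrightarrow> loc (\<psi> i) P"
  obtains k where "\<And>Q i. agree k P Q \<Longrightarrow> i \<in> A \<Longrightarrow> \<psi> i Q = \<psi> i P"
proof -
  obtain m where m: "\<And>i Q. i \<in> A \<Longrightarrow> agree (m i) P Q \<Longrightarrow> \<psi> i Q = \<psi> i P"
    using assms(2) unfolding loc_def by metis
  have "\<psi> i Q = \<psi> i P" if "agree (Max (m ` A)) P Q" "i \<in> A" for Q i
  proof (rule m[OF that(2)])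
    show "agree (m i) P Q"
      using that(1) by (rule agree_mono) (use assms(1) that(2) in simp)
  qed
  then show thesis using that by blast
qed

lemma loc_Collect:
  assumes "finite A" "\<And>i. i \<in> A \<Longrightarrow> loc (\<psi> i) P"
  shows "loc (\<lambda>Q. {i \<in> A. \<psi> i Q}) P"
proof -
  obtain k where k: "\<And>Q i. agree k P Q \<Longrightarrow> i \<in> A \<Longrightarrow> \<psi> i Q = \<psi> i P"
    using loc_finite[of A \<psi>, OF assms] by blast
  have "{i \<in> A. \<psi> i Q} = {i \<in> A. \<psi> i P}" if "agree k P Q" for Q
    using k[OF that] by blast
  then show ?thesis unfolding loc_def by blast
qed

lemma loc_ball:
  assumes "finite A" "\<And>i. i \<in> A \<Longrightarrow> loc (\<psi> i) P"
  shows "loc (\<lambda>Q. \<forall>i\<in>A. \<psi> i Q) P"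
proof -
  have "loc (\<lambda>Q. {i \<in> A. \<psi> i Q} = A) P"
    using loc_Collect[OF assms] by (rule loc_fun[where g = "\<lambda>B. B = A"])
  moreover have "(\<lambda>Q. {i \<in> A. \<psi> i Q} = A) = (\<lambda>Q. \<forall>i\<in>A. \<psi> i Q)" by blast
  ultimately show ?thesis by (simp only:)
qed

lemma loc_bex:
  assumes "finite A" "\<And>i. i \<in> A \<Longrightarrow> loc (\<psi> i) P"
  shows "loc (\<lambda>Q. \<exists>i\<in>A. \<psi> i Q) P"
proof -
  have "loc (\<lambda>Q. {i \<in> A. \<psi> i Q} \<noteq> {}) P"
    using loc_Collect[OF assms] by (rule loc_fun[where g = "\<lambda>B. B \<noteq> {}"])
  moreover have "(\<lambda>Q. {i \<in> A. \<psi> i Q} \<noteq> {}) = (\<lambda>Q. \<exists>i\<in>A. \<psi> i Q)" by blast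
  ultimately show ?thesis by (simp only:)
qed

lemma loc_all_less:
  fixes n :: nat
  assumes "\<And>i. i < n \<Longrightarrow> loc (\<psi> i) P"
  shows "loc (\<lambda>Q. \<forall>i<n. \<psi> i Q) P"
proof -
  have "loc (\<lambda>Q. \<forall>i\<in>{..<n}. \<psi> i Q) P"
    by (rule loc_ball[OF finite_lessThan]) (rule assms, simp)
  then show ?thesis by (simp only: Ball_def Bex_def lessThan_iff)
qed

lemma loc_ex_less:
  fixes n :: nat
  assumes "\<And>i. i < n \<Longrightarrow> loc (\<psi> i) P"
  shows "loc (\<lambda>Q. \<exists>i<n. \<psi> i Q) P"
proof -
  have "loc (\<lambda>Q. \<exists>i\<in>{..<n}. \<psi> i Q) P"
    by (rule loc_bex[OF finite_lessThan]) (rule assms, simp)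
  then show ?thesis by (simp only: Ball_def Bex_def lessThan_iff)
qed

lemma loc_ex_le:
  fixes n :: nat
  assumes "\<And>i. i \<le> n \<Longrightarrow> loc (\<psi> i) P"
  shows "loc (\<lambda>Q. \<exists>i\<le>n. \<psi> i Q) P"
proof -
  have "loc (\<lambda>Q. \<exists>i\<in>{..n}. \<psi> i Q) P"
    by (rule loc_bex[OF finite_atMost]) (rule assms, simp)
  then show ?thesis by (simp only: Ball_def Bex_def atMost_iff)
qed

lemma loc_map:
  assumes "\<And>i. i \<in> set xs \<Longrightarrow> loc (\<lambda>Q. f Q i) P"
  shows "loc (\<lambda>Q. map (f Q) xs) P"
proof -
  obtain k where k: "\<And>Q i. agree k P Q \<Longrightarrow> i \<in> set xs \<Longrightarrow> f Q i = f P i"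
    using loc_finite[of "set xs" "\<lambda>i Q. f Q i" P, OF _ assms] by blast
  have "map (f Q) xs = map (f P) xs" if "agree k P Q" for Q
    using k[OF that] by (rule map_cong[OF refl])
  then show ?thesis unfolding loc_def by blast
qed

text \<open>A search that succeeds at \<open>P\<close> inspects only the finitely many candidates up
  to the least witness; fixing these answers fixes the result.\<close>

lemma loc_Least:
  fixes \<psi> :: "nat \<Rightarrow> orc \<Rightarrow> bool"
  assumes "\<psi> i P" "\<And>i. loc (\<psi> i) P"
  shows "loc (\<lambda>Q. LEAST i. \<psi> i Q) P"
proof -
  let ?n = "LEAST i. \<psi> i P"
  obtain k where k: "\<And>Q i. agree k P Q \<Longrightarrow> i \<in> {..?n} \<Longrightarrow> \<psi> i Q = \<psi> i P"
    using loc_finite[of "{..?n}" \<psi> P] assms(2) by blast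
  have n: "\<psi> ?n P" using assms(1) by (rule LeastI)
  have "(LEAST i. \<psi> i Q) = ?n" if "agree k P Q" for Q
  proof (rule Least_equality)
    show "\<psi> ?n Q" using k[OF that] n by blast
    show "?n \<le> y" if "\<psi> y Q" for y
    proof (rule ccontr)
      assume "\<not> ?n \<le> y"
      then have "\<psi> y P" using k[OF \<open>agree k P Q\<close>, of y] that by simp
      then show False using \<open>\<not> ?n \<le> y\<close> by (simp add: Least_le)
    qed
  qed
  then show ?thesis unfolding loc_def by blast
qed

lemma loc_comp:
  assumes c: "cont \<Theta> P" and "loc \<phi> (\<Theta> P)"
  shows "loc (\<lambda>Q. \<phi> (\<Theta> Q)) P"
proof -
  obtain k where k: "\<And>Q. agree k (\<Theta> P) Q \<Longrightarrow> \<phi> Q = \<phi> (\<Theta> P)"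
    using assms(2) unfolding loc_def by blast
  obtain l where l: "\<And>Q i. agree l P Q \<Longrightarrow> i \<in> {..<k} \<Longrightarrow> \<Theta> Q i = \<Theta> P i"
    using loc_finite[of "{..<k}" "\<lambda>i Q. \<Theta> Q i" P] c unfolding cont_def by blast
  have "agree k (\<Theta> P) (\<Theta> Q)" if "agree l P Q" for Q
    using l[OF that] unfolding agree_def by blast
  then show ?thesis unfolding loc_def using k by blast
qed

section \<open>Joins of oracles\<close>

definition join :: "orc \<Rightarrow> orc \<Rightarrow> orc" where
  "join P Q = (\<lambda>i. if even i then P (i div 2) else Q (i div 2))"

definition lft :: "orc \<Rightarrow> orc" where "lft P = (\<lambda>i. P (2 * i))"
definition rgt :: "orc \<Rightarrow> orc" where "rgt P = (\<lambda>i. P (Suc (2 * i)))"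

lemma lft_join [simp]: "lft (join P Q) = P"
  and rgt_join [simp]: "rgt (join P Q) = Q"
  by (auto simp: lft_def rgt_def join_def)

lemma cont_lft: "cont lft P" and cont_rgt: "cont rgt P"
  by (auto simp: cont_def lft_def rgt_def loc_app)

lemma loc_lft: "loc (\<lambda>Q. lft Q n) P" and loc_rgt: "loc (\<lambda>Q. rgt Q n) P"
  by (auto simp: lft_def rgt_def loc_app)

section \<open>A countable family of functionals\<close>

instance tm :: countable by countable_datatype
instance fm :: countable by countable_datatype

text \<open>Finite codes keep the family countable, so that one oracle can list it and the tower can
  run through it. \<open>OCol\<close> reads one column of the oracle; \<open>ODelta\<close> carries
  an instance of comprehension with its parameters as finite lists.\<close>

datatype opterm =
    OId | OZero | OLft | ORgt | OCol opterm | OSig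
  | ODelta fm fm name name name "(name \<times> nat) list" "name list"
  | ONeq | OEqu | OSim | OBig | OIn | OCon | ORain | ODiag
  | OComp opterm opterm | OJoin opterm opterm

instance opterm :: countable by countable_datatype

text \<open>An unbounded existential quantifier. It is discontinuous wherever its value is 0, which
  is why applying it costs a jump.\<close>

definition sigm :: "orc \<Rightarrow> orc" where
  "sigm P = (\<lambda>n. if \<exists>t::nat. P (to_nat (n, t)) = 1 then 1 else 0)"

text \<open>The sets named by \<open>Xs\<close> are the columns of a right-nested join.\<close>

fun cols :: "name list \<Rightarrow> orc \<Rightarrow> name \<Rightarrow> nat set" where
  "cols [] P X = {}"
| "cols (Y # Ys) P X = (if X = Y then {i. lft P i = 1} else cols Ys (rgt P) X)"

definition lookup :: "(name \<times> nat) list \<Rightarrow> name \<Rightarrow> nat" where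
  "lookup vs x = (case map_of vs x of None \<Rightarrow> 0 | Some a \<Rightarrow> a)"

text \<open>The usual decision procedure for a set that is both Sigma^0_1 and Pi^0_1: a simultaneous
  search for a witness of \<open>\<theta>\<close> and a counterexample to
  \<open>\<theta>'\<close>.\<close>

definition deltaF :: "fm \<Rightarrow> fm \<Rightarrow> name \<Rightarrow> name \<Rightarrow> name \<Rightarrow> (name \<times> nat) list \<Rightarrow> name list \<Rightarrow> orc \<Rightarrow> orc" where
  "deltaF \<theta> \<theta>' x x' n vs Xs P = (\<lambda>m.
    let t = LEAST t. sat {} ((lookup vs)(n := m, x := t)) (cols Xs P) \<theta> \<or>
          \<not> sat {} ((lookup vs)(n := m, x' := t)) (cols Xs P) \<theta>'
    in if sat {} ((lookup vs)(n := m, x := t)) (cols Xs P) \<theta> then 1 else 0)"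

definition pr :: "nat \<Rightarrow> nat \<Rightarrow> nat" where
  "pr i j = (i + j) * (i + j) + i"

definition colour :: "orc \<Rightarrow> nat \<Rightarrow> nat \<Rightarrow> nat" where
  "colour P x s = (LEAST c. P (pr (pr x s) c) = 1)"

text \<open>A matrix for \<open>sigm\<close>: quantified over \<open>t\<close>, it says that
  \<open>b\<close> fails as a bound for eventual equality of colours. The tests \<open>x < t\<close>
  and \<open>y < t\<close> guard \<open>colour\<close>, whose search has an answer only
  there.\<close>

definition neqF :: "orc \<Rightarrow> orc" where
  "neqF P = (\<lambda>i. case from_nat i of (n :: nat, t) \<Rightarrow> case from_nat n of (x, y, b) \<Rightarrow>
    if b < t \<and> \<not> (x < t \<and> y < t \<and> colour P x t = colour P y t) then 1 else 0)"

definition equF :: "orc \<Rightarrow> orc" where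
  "equF P = (\<lambda>i. case from_nat i of (n :: nat, t) \<Rightarrow> case from_nat n of (x, y, b) \<Rightarrow>
    if b < t \<and> \<not> (x < t \<and> y < t \<and> colour P x t \<noteq> colour P y t) then 1 else 0)"

definition simF :: "orc \<Rightarrow> orc" where
  "simF P = (\<lambda>i. case from_nat i of (x :: nat, y :: nat) \<Rightarrow>
    let b = LEAST b :: nat. lft P (to_nat (x, y, b)) \<noteq> 1 \<or> rgt P (to_nat (x, y, b)) \<noteq> 1
    in if lft P (to_nat (x, y, b)) \<noteq> 1 then 1 else 0)"

text \<open>The padding is never inspected: \<open>forces\<close> reads at most
  \<open>2 * length \<tau>\<close> entries of the join.\<close>

definition ext :: "nat list \<Rightarrow> orc" where
  "ext \<tau> i = (if i < length \<tau> then \<tau> ! i else 0)"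

text \<open>The finite part \<open>\<tau>\<close> of \<open>G\<close> already puts \<open>q\<close> into the jump of \<open>join X G\<close>; here
  \<open>P = join H X\<close>.\<close>

definition forces :: "orc \<Rightarrow> nat \<Rightarrow> nat list \<Rightarrow> bool" where
  "forces P q \<tau> \<longleftrightarrow> (case from_nat q of (t :: opterm, n :: nat) \<Rightarrow>
    \<exists>k\<le>2 * length \<tau>. lft P (to_nat (t, n, map (join (rgt P) (ext \<tau>)) [0..<k])) = 1)"

definition forcesF :: "orc \<Rightarrow> orc" where
  "forcesF P = (\<lambda>i. case from_nat i of (q, \<tau>) \<Rightarrow> if forces P q \<tau> then 1 else 0)"

text \<open>Every inner node \<open>\<tau>\<close> of a bushy tree keeps a child after removal of those equivalent to
  an entry of \<open>\<tau>\<close>, of which there will be at most \<open>2 * length \<tau>\<close>.\<close>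

inductive Big :: "nat \<Rightarrow> nat list set \<Rightarrow> nat list \<Rightarrow> bool" for k B where
  leaf: "\<sigma> \<in> B \<Longrightarrow> Big k B \<sigma>"
| node: "finite D \<Longrightarrow> k * (2 * length \<sigma> + 1) \<le> card D \<Longrightarrow> (\<And>a. a \<in> D \<Longrightarrow> Big k B (\<sigma> @ [a])) \<Longrightarrow>
    Big k B \<sigma>"

text \<open>The bound \<open>t\<close> leaves a finite target, which makes the functional
  continuous; \<open>sigm\<close> then recovers bigness for the whole target, because bushy trees
  are finite.\<close>

definition bigF :: "orc \<Rightarrow> orc" where
  "bigF P = (\<lambda>i. case from_nat i of (n :: nat, t) \<Rightarrow> case from_nat n of (k, E, \<sigma>) \<Rightarrow>
    if Big k {\<tau>. to_nat \<tau> < t \<and> (\<exists>q\<in>set E. forces P q \<tau>)} \<sigma> then 1 else 0)"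

text \<open>The three columns of the oracle are the characteristic functions of bigness, of
  \<open>forces\<close> and of the equivalence.  A condition \<open>(\<sigma>, E)\<close> consists of an initial segment of
  the sequence and of the queries decided negatively so far.\<close>

definition isbig :: "orc \<Rightarrow> nat \<Rightarrow> nat list \<Rightarrow> nat list \<Rightarrow> bool" where
  "isbig P k E \<sigma> \<longleftrightarrow> lft P (to_nat (k, E, \<sigma>)) = 1"

definition good :: "orc \<Rightarrow> nat list \<Rightarrow> bool" where
  "good P \<tau> \<longleftrightarrow> (\<forall>j<length \<tau>. \<forall>i<j. rgt (rgt P) (to_nat (\<tau> ! i, \<tau> ! j)) \<noteq> 1)"

definition cand :: "orc \<Rightarrow> nat \<Rightarrow> nat list \<times> nat list \<Rightarrow> nat list \<Rightarrow> bool" where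
  "cand P n c \<tau> \<longleftrightarrow> prefix (fst c) \<tau> \<and> good P \<tau> \<and> \<not> isbig P (length (snd c) + 1) (snd c) \<tau> \<and>
    lft (rgt P) (to_nat (n, \<tau>)) = 1"

text \<open>The threshold exceeds that of the invariant by one. After a negative answer it is the
  right one for the longer list of queries; after a positive answer the extra unit pays for pairwise
  inequivalence.\<close>

definition yes :: "orc \<Rightarrow> nat \<Rightarrow> nat list \<times> nat list \<Rightarrow> bool" where
  "yes P n c \<longleftrightarrow> isbig P (length (snd c) + 2) (n # snd c) (fst c)"

definition decide :: "orc \<Rightarrow> nat \<Rightarrow> nat list \<times> nat list \<Rightarrow> nat list \<times> nat list" where
  "decide P n c = (if yes P n c then (from_nat (LEAST i. cand P n c (from_nat i)), snd c)
    else (fst c, n # snd c))"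

definition grows :: "orc \<Rightarrow> nat list \<times> nat list \<Rightarrow> nat \<Rightarrow> bool" where
  "grows P c a \<longleftrightarrow> good P (fst c @ [a]) \<and> \<not> isbig P (length (snd c) + 1) (snd c) (fst c @ [a])"

definition extend :: "orc \<Rightarrow> nat list \<times> nat list \<Rightarrow> nat list \<times> nat list" where
  "extend P c = (fst c @ [LEAST a. grows P c a], snd c)"

primrec stage :: "orc \<Rightarrow> nat \<Rightarrow> nat list \<times> nat list" where
  "stage P 0 = ([], [])"
| "stage P (Suc n) = extend P (decide P n (stage P n))"

definition jumpF :: "orc \<Rightarrow> orc" where
  "jumpF P = (\<lambda>n. if yes P n (stage P n) then 1 else 0)"

definition rainbow_for :: "orc \<Rightarrow> nat set \<Rightarrow> bool" where
  "rainbow_for P R \<longleftrightarrow> (\<forall>x\<in>R. \<forall>s\<in>R. \<forall>y\<in>R. \<forall>t\<in>R.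
    x < s \<and> y < t \<longrightarrow> colour P x s = colour P y t \<longrightarrow> x = y \<and> s = t)"

definition rainbow_next :: "orc \<Rightarrow> nat set \<Rightarrow> nat \<Rightarrow> bool" where
  "rainbow_next P R a \<longleftrightarrow> (\<forall>x\<in>R. x < a) \<and> rainbow_for (lft P) (insert a R)"

primrec rainbow_stage :: "orc \<Rightarrow> nat \<Rightarrow> nat set" where
  "rainbow_stage P 0 = {}"
| "rainbow_stage P (Suc n) =
    insert (rgt P (LEAST i. rainbow_next P (rainbow_stage P n) (rgt P i))) (rainbow_stage P n)"

text \<open>Numbers enter in increasing order and the one added at step \<open>n\<close> is at least
  \<open>n\<close>, so \<open>x\<close> can enter no later than stage \<open>Suc x\<close>.\<close>

definition rainbowF :: "orc \<Rightarrow> orc" where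
  "rainbowF P = (\<lambda>x. if x \<in> rainbow_stage P (Suc x) then 1 else 0)"

text \<open>\<open>jump_stage H s\<close> approximates the jump of \<open>H\<close>, and \<open>guessed H e s\<close> is the resulting guess at
  the set computed from that jump by the functional with index \<open>e\<close>.  In \<open>matching_stage H s e = (U, \<rho>)\<close>,
  \<open>U\<close> is the set of matched numbers, and two numbers are matched iff they have the same image
  under \<open>\<rho>\<close>.\<close>

definition jump_stage :: "orc \<Rightarrow> nat \<Rightarrow> orc" where
  "jump_stage H s = (\<lambda>i. case from_nat i of (t :: opterm, n :: nat) \<Rightarrow>
    if \<exists>k<s. H (to_nat (t, n, map H [0..<k])) = 1 then 1 else 0)"

definition guessed :: "orc \<Rightarrow> nat \<Rightarrow> nat \<Rightarrow> nat \<Rightarrow> bool" where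
  "guessed H e s x \<longleftrightarrow> (\<exists>k<s. H (to_nat (from_nat e :: opterm, x, map (jump_stage H s) [0..<k])) = 1)"

text \<open>The two least free guesses are taken because only small guesses are known to be correct:
  two correct free guesses below \<open>N\<close> ensure that the chosen pair lies below
  \<open>N\<close>.\<close>

definition addpair :: "nat set \<Rightarrow> nat set \<times> (nat \<Rightarrow> nat) \<Rightarrow> nat set \<times> (nat \<Rightarrow> nat)" where
  "addpair G c = (let V = G - fst c; a = Min V; b = Min (V - {a}) in
    if 2 \<le> card V then (fst c \<union> {a, b}, (snd c)(b := a)) else c)"

primrec matching_stage :: "orc \<Rightarrow> nat \<Rightarrow> nat \<Rightarrow> nat set \<times> (nat \<Rightarrow> nat)" where
  "matching_stage H s 0 = ({}, id)"
| "matching_stage H s (Suc e) = addpair {x\<in>{..<s}. guessed H e s x} (matching_stage H s e)"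

text \<open>The stage is part of the colour, so pairs with different upper ends never share one. In
  \<open>matching_stage H s s\<close> exactly the indices below \<open>s\<close> have acted.\<close>

definition diag_colour :: "orc \<Rightarrow> nat \<Rightarrow> nat \<Rightarrow> nat" where
  "diag_colour H x s = to_nat (s, snd (matching_stage H s s) x)"

definition diagF :: "orc \<Rightarrow> orc" where
  "diagF H = (\<lambda>z. if \<exists>p\<in>{(x, s, c). x < s \<and> z = pr (pr x s) c}. snd (snd p) = diag_colour H (fst p) (fst (snd p))
    then 1 else 0)"

primrec ev :: "opterm \<Rightarrow> orc \<Rightarrow> orc" where
  "ev OId = (\<lambda>P. P)"
| "ev OZero = (\<lambda>P n. 0)"
| "ev OLft = lft"
| "ev ORgt = rgt"
| "ev (OCol t) = (\<lambda>P n. P (to_nat (t, n)))"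
| "ev OSig = sigm"
| "ev (ODelta \<theta> \<theta>' x x' n vs Xs) = deltaF \<theta> \<theta>' x x' n vs Xs"
| "ev ONeq = neqF"
| "ev OEqu = equF"
| "ev OSim = simF"
| "ev OBig = bigF"
| "ev OIn = forcesF"
| "ev OCon = jumpF"
| "ev ORain = rainbowF"
| "ev ODiag = diagF"
| "ev (OComp a b) = (\<lambda>P. ev a (ev b P))"
| "ev (OJoin a b) = (\<lambda>P. join (ev a P) (ev b P))"

section \<open>Reducibility, the jump and lowness\<close>

text \<open>Continuity at \<open>Q\<close> alone corresponds to a partial functional that has to
  converge only on the given oracle.\<close>

definition red :: "orc \<Rightarrow> orc \<Rightarrow> bool" where
  "red P Q \<longleftrightarrow> (\<exists>t. P = ev t Q \<and> cont (ev t) Q)"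

lemma redI: "P = ev t Q \<Longrightarrow> cont (ev t) Q \<Longrightarrow> red P Q"
  unfolding red_def by blast

lemma red_refl: "red P P"
  by (rule redI[of _ OId]) (simp_all add: cont_def loc_app)

lemma red_trans:
  assumes "red P Q" "red Q R"
  shows "red P R"
proof -
  obtain s t where s: "P = ev s Q" "cont (ev s) Q" and t: "Q = ev t R" "cont (ev t) R"
    using assms unfolding red_def by blast
  show ?thesis
  proof (rule redI[of _ "OComp s t"])
    show "P = ev (OComp s t) R" by (simp add: s(1) flip: t(1))
    show "cont (ev (OComp s t)) R"
      unfolding cont_def
    proof
      fix n
      have "loc (\<lambda>S. ev s S n) (ev t R)" using s(2) by (simp add: cont_def flip: t(1))
      with t(2) have "loc (\<lambda>S. ev s (ev t S) n) R"
        by (rule loc_comp[where \<Theta> = "ev t" and \<phi> = "\<lambda>S. ev s S n"])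
      then show "loc (\<lambda>S. ev (OComp s t) S n) R" by simp
    qed
  qed
qed

lemma red_join:
  assumes "red P R" "red Q R"
  shows "red (join P Q) R"
proof -
  obtain s t where s: "P = ev s R" "cont (ev s) R" and t: "Q = ev t R" "cont (ev t) R"
    using assms unfolding red_def by blast
  show ?thesis
  proof (rule redI[of _ "OJoin s t"])
    show "join P Q = ev (OJoin s t) R" by (simp add: s(1) t(1))
    have "loc (\<lambda>S. join (ev s S) (ev t S) n) R" for n
      using s(2) t(2) by (cases "even n") (simp_all add: join_def cont_def)
    then show "cont (ev (OJoin s t)) R" by (simp add: cont_def)
  qed
qed

lemma red_join_left: "red P (join P Q)"
  by (rule redI[of _ OLft]) (simp_all add: cont_lft)

lemma red_join_right: "red Q (join P Q)"
  by (rule redI[of _ ORgt]) (simp_all add: cont_rgt)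

lemma red_zero: "red (\<lambda>_. 0) P"
  by (rule redI[of _ OZero]) (simp_all add: cont_def loc_const)

text \<open>Since \<open>listing\<close> mentions arbitrary oracles, it makes all functionals uniformly available to
  the oracles above it.\<close>

definition listing :: orc where
  "listing = (\<lambda>i. case from_nat i of (t, n, l) \<Rightarrow>
    if \<forall>P. map P [0..<length l] = l \<longrightarrow> ev t P n = 1 then 1 else 0)"

text \<open>No continuity is required here: the value \<open>1\<close> only has to be forced by a finite part.\<close>

definition jump :: "orc \<Rightarrow> orc" where
  "jump P = (\<lambda>i. case from_nat i of (t :: opterm, n :: nat) \<Rightarrow>
    if \<exists>k. listing (to_nat (t, n, map P [0..<k])) = 1 then 1 else 0)"

lemma agree_map: "agree k P Q \<longleftrightarrow> map Q [0..<k] = map P [0..<k]"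
  by (auto simp: agree_def)

lemma listing_iff: "listing (to_nat (t, n, map P [0..<k])) = 1 \<longleftrightarrow> (\<forall>Q. agree k P Q \<longrightarrow> ev t Q n = 1)"
  by (simp add: listing_def agree_map del: One_nat_def)

lemma jump_iff: "jump P (to_nat (t, n)) = 1 \<longleftrightarrow> (\<exists>k. \<forall>Q. agree k P Q \<longrightarrow> ev t Q n = 1)"
  by (simp add: jump_def listing_iff del: One_nat_def)

lemma jumpD: "jump P (to_nat (t, n)) = 1 \<Longrightarrow> ev t P n = 1"
  unfolding jump_iff by (metis agree_refl)

lemma jumpI: "(\<And>Q. agree k P Q \<Longrightarrow> ev t Q n = 1) \<Longrightarrow> jump P (to_nat (t, n)) = 1"
  unfolding jump_iff by blast

lemma jump_01: "jump P i = 0 \<or> jump P i = 1"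
  by (auto simp: jump_def split: prod.splits)

lemma red_jump:
  fixes t :: opterm
  assumes "\<And>n. P n = (if jump Q (to_nat (t, n)) = 1 then 1 else 0)"
  shows "red P (jump Q)"
proof (rule redI[of _ "OCol t"])
  show "P = ev (OCol t) (jump Q)"
  proof
    show "P n = ev (OCol t) (jump Q) n" for n
      using assms[of n] jump_01[of Q "to_nat (t, n)"] by auto
  qed
qed (simp add: cont_def loc_app)

lemma sigm_iff: "sigm P n = 1 \<longleftrightarrow> (\<exists>t::nat. P (to_nat (n, t)) = 1)"
  by (simp add: sigm_def)

text \<open>A positive answer rests on one witness, whose value is preserved on a neighbourhood of
  \<open>Q\<close>, so it is forced by a finite part. A forced answer is correct because
  \<open>Q\<close> itself extends that part.\<close>

lemma sigm_red_jump:
  assumes "red P Q"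
  shows "red (sigm P) (jump Q)"
proof -
  obtain t where t: "P = ev t Q" "cont (ev t) Q"
    using assms unfolding red_def by blast
  show ?thesis
  proof (rule red_jump[of _ _ "OComp OSig t"])
    fix n :: nat
    have "sigm P n = 1 \<longleftrightarrow> jump Q (to_nat (OComp OSig t, n)) = 1"
    proof
      assume "sigm P n = 1"
      then obtain m :: nat where m: "ev t Q (to_nat (n, m)) = 1"
        unfolding sigm_iff t(1) by blast
      obtain k where k: "\<And>R. agree k Q R \<Longrightarrow> ev t R (to_nat (n, m)) = ev t Q (to_nat (n, m))"
        using t(2) unfolding cont_def loc_def by blast
      have "ev (OComp OSig t) R n = 1" if "agree k Q R" for R
      proof -
        have "sigm (ev t R) n = 1"
          unfolding sigm_iff using k[OF that] m by (intro exI[of _ m]) argo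
        then show ?thesis by simp
      qed
      then show "jump Q (to_nat (OComp OSig t, n)) = 1" by (rule jumpI)
    next
      assume "jump Q (to_nat (OComp OSig t, n)) = 1"
      then have "ev (OComp OSig t) Q n = 1" by (rule jumpD)
      then show "sigm P n = 1" by (simp add: t(1))
    qed
    then show "sigm P n = (if jump Q (to_nat (OComp OSig t, n)) = 1 then 1 else 0)"
      by (simp add: sigm_def split: if_split_asm)
  qed
qed

text \<open>Continuity forces every value 1 by a finite part, and any other value is 0, so the jump
  determines the function.\<close>

lemma red_jump_01:
  assumes "red P Q" "\<And>n. P n = 0 \<or> P n = 1"
  shows "red P (jump Q)"
proof -
  obtain t where t: "P = ev t Q" "cont (ev t) Q"
    using assms unfolding red_def by blast
  show ?thesis
  proof (rule red_jump[of _ _ t])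
    fix n
    obtain k where k: "\<And>R. agree k Q R \<Longrightarrow> ev t R n = ev t Q n"
      using t(2) unfolding cont_def loc_def by blast
    have "P n = 1 \<longleftrightarrow> jump Q (to_nat (t, n)) = 1"
      unfolding t(1)
    proof
      assume "ev t Q n = 1"
      then have "ev t R n = 1" if "agree k Q R" for R using k[OF that] by argo
      then show "jump Q (to_nat (t, n)) = 1" by (rule jumpI)
    qed (rule jumpD)
    then show "P n = (if jump Q (to_nat (t, n)) = 1 then 1 else 0)"
      using assms(2)[of n] by auto
  qed
qed

definition low :: "orc \<Rightarrow> bool" where
  "low P \<longleftrightarrow> red listing P \<and> red (jump P) (jump listing)"

lemma low_listing: "low listing"
  by (simp add: low_def red_refl)

section \<open>Comprehension\<close>

lemma loc_cols: "loc (\<lambda>Q. i \<in> cols Xs Q X) P"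
proof (induction Xs arbitrary: P)
  case Nil
  then show ?case by (simp add: loc_const)
next
  case (Cons Y Ys)
  show ?case
  proof (cases "X = Y")
    case True
    then show ?thesis using loc_fun[OF loc_lft, where g = "\<lambda>a. a = 1"] by simp
  next
    case False
    then show ?thesis
      using loc_comp[OF cont_rgt, where \<phi> = "\<lambda>Q. i \<in> cols Ys Q X", OF Cons] by simp
  qed
qed

text \<open>A bounded quantifier is a finite conjunction or disjunction, and its bound does not
  depend on the oracle.\<close>

lemma loc_sat: "Delta00 \<theta> \<Longrightarrow> loc (\<lambda>Q. sat {} v (cols Xs Q) \<theta>) P"
proof (induction arbitrary: v rule: Delta00.induct)
  case (5 \<phi> \<psi>)
  then show ?case
    using loc_imp[of "\<lambda>Q. sat {} v (cols Xs Q) \<phi>" P "\<lambda>Q. sat {} v (cols Xs Q) \<psi>"]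
    by (simp only: sat.simps)
next
  case (6 \<phi> x t)
  have t: "tval (v(x := a)) t = tval v t" for a
    using 6 by (intro tval_cong) auto
  have "sat {} v E (AllN x (Var x \<^bold>< t \<^bold>\<rightarrow> \<phi>)) \<longleftrightarrow> (\<forall>a<tval v t. sat {} (v(x := a)) E \<phi>)" for E
    by (simp add: t)
  then show ?case
    using loc_all_less[of "tval v t" "\<lambda>a Q. sat {} (v(x := a)) (cols Xs Q) \<phi>" P, OF 6(3)]
    by (simp only:)
next
  case (7 \<phi> x t)
  have t: "tval (v(x := a)) t = tval v t" for a
    using 7 by (intro tval_cong) auto
  have "sat {} v E (ExN x (Var x \<^bold>< t \<^bold>\<and> \<phi>)) \<longleftrightarrow> (\<exists>a<tval v t. sat {} (v(x := a)) E \<phi>)" for E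
    by (auto simp: t)
  then show ?case
    using loc_ex_less[of "tval v t" "\<lambda>a Q. sat {} (v(x := a)) (cols Xs Q) \<phi>" P, OF 7(3)]
    by (simp only:)
qed (simp_all add: loc_const loc_cols)

lemma cont_deltaF:
  assumes "Delta00 \<theta>" "Delta00 \<theta>'"
    and "\<And>m. \<exists>t. sat {} ((lookup vs)(n := m, x := t)) (cols Xs P) \<theta> \<or>
          \<not> sat {} ((lookup vs)(n := m, x' := t)) (cols Xs P) \<theta>'"
  shows "cont (deltaF \<theta> \<theta>' x x' n vs Xs) P"
  unfolding cont_def
proof
  fix m
  let ?a = "\<lambda>t Q. sat {} ((lookup vs)(n := m, x := t)) (cols Xs Q) \<theta>"
  let ?b = "\<lambda>t Q. sat {} ((lookup vs)(n := m, x' := t)) (cols Xs Q) \<theta>'"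
  obtain t where "?a t P \<or> \<not> ?b t P" using assms(3) by blast
  moreover have "loc (\<lambda>Q. ?a t Q \<or> \<not> ?b t Q) P" for t
    using loc_sat[OF assms(1)] loc_sat[OF assms(2)]
    by (rule loc_fun2[where g = "\<lambda>c d. c \<or> \<not> d"])
  ultimately have "loc (\<lambda>Q. LEAST t. ?a t Q \<or> \<not> ?b t Q) P"
    by (rule loc_Least[where \<psi> = "\<lambda>t Q. ?a t Q \<or> \<not> ?b t Q"])
  then have "loc (\<lambda>Q. if ?a (LEAST t. ?a t Q \<or> \<not> ?b t Q) Q then 1 else 0 :: nat) P"
    by (rule loc_bind[where \<psi> = "\<lambda>t Q. if ?a t Q then 1 else 0"])
      (rule loc_fun[OF loc_sat[OF assms(1)], where g = "\<lambda>c. if c then 1 else 0"])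
  then show "loc (\<lambda>Q. deltaF \<theta> \<theta>' x x' n vs Xs Q m) P"
    by (simp only: deltaF_def Let_def)
qed

definition chi :: "nat set \<Rightarrow> orc" where
  "chi A = (\<lambda>i. if i \<in> A then 1 else 0)"

lemma chi_1 [simp]: "chi A i = Suc 0 \<longleftrightarrow> i \<in> A"
  by (simp add: chi_def)

text \<open>Together with the downward closure built into \<open>sets_below\<close> this is the
  analogue of a Turing ideal, given by generators.\<close>

definition ideal :: "orc set \<Rightarrow> bool" where
  "ideal I \<longleftrightarrow> I \<noteq> {} \<and> (\<forall>X\<in>I. \<forall>Y\<in>I. \<exists>Z\<in>I. red X Z \<and> red Y Z)"

definition sets_below :: "orc set \<Rightarrow> nat set set" where
  "sets_below I = {A. \<exists>X\<in>I. red (chi A) X}"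

text \<open>Directedness collects finitely many set parameters below one oracle, in the nested form
  that \<open>cols\<close> decodes.\<close>

lemma ideal_cols:
  assumes "ideal I" "\<And>X. E X \<in> sets_below I"
  shows "\<exists>Z\<in>I. \<exists>P. red P Z \<and> (\<forall>X\<in>set Xs. cols Xs P X = E X)"
proof (induction Xs)
  case Nil
  then show ?case using assms(1) red_zero by (auto simp: ideal_def)
next
  case (Cons Y Ys)
  then obtain Z P where Z: "Z \<in> I" "red P Z" "\<forall>X\<in>set Ys. cols Ys P X = E X" by blast
  obtain W where W: "W \<in> I" "red (chi (E Y)) W" using assms(2) by (auto simp: sets_below_def)
  obtain V where V: "V \<in> I" "red Z V" "red W V"
    using assms(1) Z(1) W(1) unfolding ideal_def by blast
  have "red (join (chi (E Y)) P) V"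
    using red_trans Z(2) W(2) V(2,3) by (blast intro: red_join)
  moreover have "\<forall>X\<in>set (Y # Ys). cols (Y # Ys) (join (chi (E Y)) P) X = E X"
    using Z(3) by simp
  ultimately show ?case using V(1) by blast
qed

lemma lookup_map: "y \<in> set ys \<Longrightarrow> lookup (map (\<lambda>y. (y, v y)) ys) y = v y"
  by (induction ys) (auto simp: lookup_def)

lemma comprehension:
  assumes I: "ideal I" and E: "\<And>X. E X \<in> sets_below I"
    and d: "Delta00 \<theta>" "Delta00 \<theta>'"
    and eq: "\<And>m. sat M (v(n := m)) E (ExN x \<theta>) = sat M (v(n := m)) E (AllN x' \<theta>')"
  shows "{m. sat M (v(n := m)) E (ExN x \<theta>)} \<in> sets_below I"
proof -
  obtain Xs where Xs: "set Xs = fvS \<theta> \<union> fvS \<theta>'"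
    using finite_list[of "fvS \<theta> \<union> fvS \<theta>'"] finite_fvS by blast
  obtain ys where ys: "set ys = fv \<theta> \<union> fv \<theta>'"
    using finite_list[of "fv \<theta> \<union> fv \<theta>'"] finite_fv by blast
  define vs where "vs = map (\<lambda>y. (y, v y)) ys"
  obtain Z P where Z: "Z \<in> I" "red P Z" "\<And>X. X \<in> set Xs \<Longrightarrow> cols Xs P X = E X"
    using ideal_cols[OF I, of E Xs, OF E] by blast
  have a: "sat {} ((lookup vs)(n := m, x := t)) (cols Xs P) \<theta> = sat M (v(n := m, x := t)) E \<theta>" for m t
  proof -
    have "sat {} ((lookup vs)(n := m, x := t)) (cols Xs P) \<theta> =
        sat M ((lookup vs)(n := m, x := t)) (cols Xs P) \<theta>"
      by (rule sat_Delta00[OF d(1)])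
    also have "\<dots> = sat M (v(n := m, x := t)) E \<theta>"
      using Z(3) Xs ys by (intro sat_cong) (auto simp: vs_def lookup_map)
    finally show ?thesis .
  qed
  have b: "sat {} ((lookup vs)(n := m, x' := t)) (cols Xs P) \<theta>' = sat M (v(n := m, x' := t)) E \<theta>'" for m t
  proof -
    have "sat {} ((lookup vs)(n := m, x' := t)) (cols Xs P) \<theta>' =
        sat M ((lookup vs)(n := m, x' := t)) (cols Xs P) \<theta>'"
      by (rule sat_Delta00[OF d(2)])
    also have "\<dots> = sat M (v(n := m, x' := t)) E \<theta>'"
      using Z(3) Xs ys by (intro sat_cong) (auto simp: vs_def lookup_map)
    finally show ?thesis .
  qed
  let ?a = "\<lambda>m t. sat M (v(n := m, x := t)) E \<theta>"
  let ?b = "\<lambda>m t. sat M (v(n := m, x' := t)) E \<theta>'"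
  have eq': "(\<exists>t. ?a m t) \<longleftrightarrow> (\<forall>t. ?b m t)" for m
    using eq[of m] by (simp only: sat.simps simp_thms not_all)
  then have ex: "\<exists>t. ?a m t \<or> \<not> ?b m t" for m by blast
  \<comment> \<open>If the search stops without a witness of \<open>\<theta>\<close>, it has refuted
    \<open>\<theta>'\<close>, and by the equivalence there is no witness at all.\<close>
  have "?a m (LEAST t. ?a m t \<or> \<not> ?b m t) \<longleftrightarrow> (\<exists>t. ?a m t)" for m
    using LeastI_ex[OF ex[of m]] eq'[of m] by blast
  then have "chi {m. \<exists>t. ?a m t} = deltaF \<theta> \<theta>' x x' n vs Xs P"
    unfolding deltaF_def chi_def a b Let_def by simp
  moreover have "cont (deltaF \<theta> \<theta>' x x' n vs Xs) P"
    by (rule cont_deltaF[OF d]) (simp only: a b ex)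
  ultimately have "red (chi {m. \<exists>t. ?a m t}) P"
    by (intro redI[of _ "ODelta \<theta> \<theta>' x x' n vs Xs"]) simp_all
  then have "red (chi {m. \<exists>t. ?a m t}) Z" using Z(2) red_trans by blast
  moreover have "{m. sat M (v(n := m)) E (ExN x \<theta>)} = {m. \<exists>t. ?a m t}"
    by (simp only: sat.simps simp_thms not_all)
  ultimately show ?thesis using Z(1) unfolding sets_below_def by auto
qed

lemma sat_comprehension:
  assumes I: "ideal I" and E: "\<And>X. E X \<in> sets_below I" and "\<phi> \<in> Delta01_comprehension"
  shows "sat (sets_below I) v E \<phi>"
proof -
  let ?M = "sets_below I"
  obtain n \<chi> \<psi> X where \<phi>: "\<phi> = (AllN n (\<chi> \<^bold>\<leftrightarrow> \<psi>) \<^bold>\<rightarrow> ExS X (AllN n (Var n \<^bold>\<in> X \<^bold>\<leftrightarrow> \<chi>)))"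
    and "\<chi> \<in> Sigma01" "\<psi> \<in> Pi01" and X: "X \<notin> fvS \<chi>"
    using assms(3) unfolding Delta01_comprehension_def by blast
  then obtain x \<theta> x' \<theta>' where \<chi>: "\<chi> = ExN x \<theta>" "Delta00 \<theta>" and \<psi>: "\<psi> = AllN x' \<theta>'" "Delta00 \<theta>'"
    unfolding Sigma01_def Pi01_def by blast
  have "\<exists>A\<in>?M. \<forall>a. a \<in> A \<longleftrightarrow> sat ?M (v(n := a)) (E(X := A)) \<chi>"
    if "\<And>a. sat ?M (v(n := a)) E \<chi> = sat ?M (v(n := a)) E \<psi>"
  proof -
    let ?A = "{a. sat ?M (v(n := a)) E \<chi>}"
    have "?A \<in> ?M"
      unfolding \<chi>(1) by (rule comprehension[OF I E \<chi>(2) \<psi>(2)]) (use that in \<open>simp only: \<chi>(1) \<psi>(1)\<close>)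
    moreover have "sat ?M (v(n := a)) (E(X := ?A)) \<chi> = sat ?M (v(n := a)) E \<chi>" for a
      using X by (intro sat_cong) auto
    ultimately show ?thesis by (intro bexI[of _ ?A]) auto
  qed
  then show ?thesis unfolding \<phi> by (simp del: fun_upd_apply add: fun_upd_same) metis
qed

theorem sat_RCA0:
  assumes "ideal I" "\<And>X. E X \<in> sets_below I" "\<phi> \<in> RCA0"
  shows "sat (sets_below I) v E \<phi>"
  using assms sat_basic_axioms sat_induction sat_comprehension unfolding RCA0_def by blast

section \<open>A colouring without rainbows below the jump\<close>

text \<open>The code is at least the square of \<open>i + j\<close> and less than the next square,
  so it determines the sum and then \<open>i\<close>.\<close>

lemma pr_eq_iff [simp]: "pr i j = pr k l \<longleftrightarrow> i = k \<and> j = l"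
proof
  assume eq: "pr i j = pr k l"
  have less: "pr a b < pr c d" if "a + b < c + d" for a b c d
  proof -
    have "Suc (a + b) * Suc (a + b) \<le> (c + d) * (c + d)"
      using that by (intro mult_le_mono) auto
    then show ?thesis unfolding pr_def by simp
  qed
  have "i + j = k + l" using less[of i j k l] less[of k l i j] eq by linarith
  then show "i = k \<and> j = l" using eq unfolding pr_def by simp
qed simp

definition colouring :: "nat set \<Rightarrow> bool" where
  "colouring A \<longleftrightarrow> (\<forall>z\<in>A. \<exists>x s c. x < s \<and> z = pr (pr x s) c) \<and>
    (\<forall>x s. x < s \<longrightarrow> (\<exists>c. pr (pr x s) c \<in> A \<and> (\<forall>d. pr (pr x s) d \<in> A \<longrightarrow> d = c)))"

definition bounded2 :: "nat set \<Rightarrow> bool" where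
  "bounded2 A \<longleftrightarrow> (\<forall>c p q r. pr p c \<in> A \<and> pr q c \<in> A \<and> pr r c \<in> A \<longrightarrow> p = q \<or> p = r \<or> q = r)"

definition unbounded :: "nat set \<Rightarrow> bool" where
  "unbounded R \<longleftrightarrow> (\<forall>n. \<exists>m. n < m \<and> m \<in> R)"

definition rainbow :: "nat set \<Rightarrow> nat set \<Rightarrow> bool" where
  "rainbow A R \<longleftrightarrow> (\<forall>x s y t c. x \<in> R \<and> s \<in> R \<and> x < s \<and> y \<in> R \<and> t \<in> R \<and> y < t \<and>
    pr (pr x s) c \<in> A \<and> pr (pr y t) c \<in> A \<longrightarrow> x = y \<and> s = t)"

section \<open>Matching guessed elements in pairs\<close>

lemma addpair_cases:
  fixes G :: "nat set"
  assumes "finite G"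
  obtains "addpair G c = c" "card (G - fst c) < 2"
  | a b where "addpair G c = (fst c \<union> {a, b}, (snd c)(b := a))" "a \<in> G - fst c" "b \<in> G - fst c"
      "a \<noteq> b" "\<And>N. 2 \<le> card ((G - fst c) \<inter> {..<N}) \<Longrightarrow> a < N \<and> b < N"
proof (cases "2 \<le> card (G - fst c)")
  case True
  let ?V = "G - fst c"
  let ?a = "Min ?V"
  let ?b = "Min (?V - {?a})"
  have fin: "finite ?V" using assms by blast
  have "?V \<noteq> {}" using True by (metis card.empty not_numeral_le_zero)
  then have a: "?a \<in> ?V" using fin by (rule Min_in[rotated])
  have "card (?V - {?a}) \<noteq> 0" using True a fin by simp
  then have "?V - {?a} \<noteq> {}" by (metis card.empty)
  then have b: "?b \<in> ?V - {?a}" using fin by (intro Min_in) auto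
  have ab: "?a < N \<and> ?b < N" if N: "2 \<le> card (?V \<inter> {..<N})" for N
  proof -
    have "?V \<inter> {..<N} \<noteq> {}" using N by auto
    then obtain u where u: "u \<in> ?V" "u < N" by blast
    have "?a \<le> u" using fin u(1) by (rule Min_le)
    have "card (?V \<inter> {..<N} - {?a}) \<noteq> 0"
      using N card_Diff_singleton_if[of "?V \<inter> {..<N}" ?a] by auto
    then have "?V \<inter> {..<N} - {?a} \<noteq> {}" by auto
    then obtain w where w: "w \<in> ?V - {?a}" "w < N" by blast
    have "?b \<le> w" using fin w(1) by (intro Min_le) auto
    then show ?thesis using \<open>?a \<le> u\<close> u w by linarith
  qed
  have "addpair G c = (fst c \<union> {?a, ?b}, (snd c)(?b := ?a))"
    using True by (simp add: addpair_def Let_def)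
  then show thesis
  proof (rule that(2))
    show "?a \<in> ?V" by (rule a)
    show "?b \<in> ?V" using b by blast
    show "?a \<noteq> ?b" using b by (metis DiffE singletonI)
  qed (rule ab)
next
  case False
  then show thesis using that(1) by (simp add: addpair_def Let_def)
qed

definition matching :: "nat set \<times> (nat \<Rightarrow> nat) \<Rightarrow> bool" where
  "matching c \<longleftrightarrow> finite (fst c) \<and> (\<forall>x. x \<notin> fst c \<longrightarrow> snd c x = x) \<and> (\<forall>x\<in>fst c. snd c x \<in> fst c) \<and>
    (\<forall>x y z. snd c x = snd c y \<longrightarrow> snd c y = snd c z \<longrightarrow> x = y \<or> x = z \<or> y = z)"

text \<open>Free numbers are fixed by the map and matched ones stay among the matched, so a free
  number is alone in its fibre. Redirecting \<open>b\<close> to \<open>a\<close> merges two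
  singleton fibres and leaves the others intact.\<close>

lemma matching_addpair:
  assumes "finite G" "matching c"
  shows "matching (addpair G c) \<and> card (fst (addpair G c)) \<le> card (fst c) + 2 \<and>
    (\<forall>x\<in>fst c. snd (addpair G c) x = snd c x) \<and> fst c \<subseteq> fst (addpair G c)"
  using assms(1)
proof (cases rule: addpair_cases[of G c])
  case (2 a b)
  obtain U \<rho> where c: "c = (U, \<rho>)" by fastforce
  have inv: "finite U" "\<And>x. x \<notin> U \<Longrightarrow> \<rho> x = x" "\<And>x. x \<in> U \<Longrightarrow> \<rho> x \<in> U"
    "\<And>x y z. \<rho> x = \<rho> y \<Longrightarrow> \<rho> y = \<rho> z \<Longrightarrow> x = y \<or> x = z \<or> y = z"
    using assms(2) unfolding matching_def c by auto
  have ab: "a \<notin> U" "b \<notin> U" "a \<noteq> b" using 2 c by auto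
  have fib: "\<rho> x = a \<longleftrightarrow> x = a" for x using inv(2,3) ab by metis
  let ?r = "\<rho>(b := a)"
  have r: "?r x = a \<longleftrightarrow> x = a \<or> x = b" for x using fib by auto
  have "x = y \<or> x = z \<or> y = z" if "?r x = ?r y" "?r y = ?r z" for x y z
  proof (cases "?r x = a")
    case True
    then show ?thesis using that r by metis
  next
    case False
    then have "x \<noteq> b" "y \<noteq> b" "z \<noteq> b" using that by auto
    then show ?thesis using that inv(4)[of x y z] by simp
  qed
  then have "matching (addpair G c)"
    unfolding 2(1) matching_def using inv ab by (auto simp: c)
  moreover have "card (fst (addpair G c)) \<le> card (fst c) + 2"
    unfolding 2(1) using inv(1) ab by (simp add: c)
  moreover have "\<forall>x\<in>fst c. snd (addpair G c) x = snd c x"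
    unfolding 2(1) using ab by (auto simp: c)
  moreover have "fst c \<subseteq> fst (addpair G c)" unfolding 2(1) by auto
  ultimately show ?thesis by blast
qed (use assms(2) in simp)

lemma matching_stage_matching: "matching (matching_stage H s e)"
proof (induction e)
  case 0
  then show ?case by (simp add: matching_def)
next
  case (Suc e)
  then show ?case using matching_addpair[of "{x\<in>{..<s}. guessed H e s x}"] by simp
qed

lemma card_matching_stage: "card (fst (matching_stage H s e)) \<le> 2 * e"
proof (induction e)
  case 0
  then show ?case by simp
next
  case (Suc e)
  then show ?case
    using matching_addpair[of "{x\<in>{..<s}. guessed H e s x}", OF _ matching_stage_matching, of H s e]
    by simp
qed

lemma matching_stage_mono:
  assumes "x \<in> fst (matching_stage H s e)" "e \<le> e'"
  shows "x \<in> fst (matching_stage H s e') \<and> snd (matching_stage H s e') x = snd (matching_stage H s e) x"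
  using assms(2)
proof (induction e' rule: dec_induct)
  case base
  then show ?case using assms(1) by simp
next
  case (step n)
  let ?G = "{x\<in>{..<s}. guessed H n s x}"
  have "x \<in> fst (addpair ?G (matching_stage H s n))"
    using matching_addpair[of ?G, OF _ matching_stage_matching, of H s n] step by auto
  moreover have "snd (addpair ?G (matching_stage H s n)) x = snd (matching_stage H s n) x"
    using matching_addpair[of ?G, OF _ matching_stage_matching, of H s n] step by auto
  ultimately show ?case using step by simp
qed

definition diag :: "nat set" where
  "diag = {pr (pr x s) (diag_colour listing x s) |x s. x < s}"

lemma diag_iff [simp]: "pr (pr x s) c \<in> diag \<longleftrightarrow> x < s \<and> c = diag_colour listing x s"
  by (auto simp: diag_def)

lemma colouring_diag: "colouring diag"
  unfolding colouring_def by (auto simp: diag_def)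

lemma bounded2_diag: "bounded2 diag"
  unfolding bounded2_def
proof (intro allI impI, elim conjE)
  fix c p q r
  assume p: "pr p c \<in> diag" and q: "pr q c \<in> diag" and r: "pr r c \<in> diag"
  obtain x s where x: "p = pr x s" "c = diag_colour listing x s" using p by (auto simp: diag_def)
  obtain y t where y: "q = pr y t" "c = diag_colour listing y t" using q by (auto simp: diag_def)
  obtain z u where z: "r = pr z u" "c = diag_colour listing z u" using r by (auto simp: diag_def)
  have st: "s = t" "t = u" using x(2) y(2) z(2) by (simp_all add: diag_colour_def)
  have "snd (matching_stage listing s s) x = snd (matching_stage listing s s) y"
    "snd (matching_stage listing s s) y = snd (matching_stage listing s s) z"
    using x(2) y(2) z(2) st by (simp_all add: diag_colour_def)
  then have "x = y \<or> x = z \<or> y = z"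
    using matching_stage_matching[of listing s s] unfolding matching_def by blast
  then show "p = q \<or> p = r \<or> q = r" using x y z st by auto
qed

section \<open>The colouring is below \<open>listing\<close>\<close>

lemma loc_jump_stage: "loc (\<lambda>H. jump_stage H s i) P"
proof (cases "from_nat i :: opterm \<times> nat")
  case (Pair t n)
  have "loc (\<lambda>H. H (to_nat (t, n, map H [0..<k])) = 1) P" for k
  proof -
    have "loc (\<lambda>H. map H [0..<k]) P" by (rule loc_map[where f = "\<lambda>H. H"]) (rule loc_app)
    then have "loc (\<lambda>H. to_nat (t, n, map H [0..<k])) P"
      by (rule loc_fun[where g = "\<lambda>l. to_nat (t, n, l)"])
    then have "loc (\<lambda>H. H (to_nat (t, n, map H [0..<k]))) P" by (rule loc_at)
    then show ?thesis by (rule loc_fun[where g = "\<lambda>a. a = 1"])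
  qed
  then have "loc (\<lambda>H. \<exists>k<s. H (to_nat (t, n, map H [0..<k])) = 1) P"
    by (intro loc_ex_less)
  then have "loc (\<lambda>H. if \<exists>k<s. H (to_nat (t, n, map H [0..<k])) = 1 then 1 else 0 :: nat) P"
    by (rule loc_fun[where g = "\<lambda>b. if b then 1 else 0"])
  then show ?thesis by (simp only: jump_stage_def Pair prod.case)
qed

lemma loc_guessed: "loc (\<lambda>H. guessed H e s x) P"
proof -
  have "loc (\<lambda>H. H (to_nat (from_nat e :: opterm, x, map (jump_stage H s) [0..<k])) = 1) P" for k
  proof -
    have "loc (\<lambda>H. map (jump_stage H s) [0..<k]) P"
      by (rule loc_map[where f = "\<lambda>H. jump_stage H s"]) (rule loc_jump_stage)
    then have "loc (\<lambda>H. to_nat (from_nat e :: opterm, x, map (jump_stage H s) [0..<k])) P"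
      by (rule loc_fun[where g = "\<lambda>l. to_nat (from_nat e :: opterm, x, l)"])
    then have "loc (\<lambda>H. H (to_nat (from_nat e :: opterm, x, map (jump_stage H s) [0..<k]))) P"
      by (rule loc_at)
    then show ?thesis by (rule loc_fun[where g = "\<lambda>a. a = 1"])
  qed
  then show ?thesis unfolding guessed_def by (intro loc_ex_less)
qed

lemma loc_matching_stage: "loc (\<lambda>H. matching_stage H s e) P"
proof (induction e)
  case 0
  then show ?case by (simp add: loc_const)
next
  case (Suc e)
  have "loc (\<lambda>H. {x\<in>{..<s}. guessed H e s x}) P"
    by (rule loc_Collect[OF finite_lessThan]) (rule loc_guessed)
  then have "loc (\<lambda>H. addpair {x\<in>{..<s}. guessed H e s x} (matching_stage H s e)) P"
    using Suc by (rule loc_fun2[where g = addpair])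
  then show ?case by (simp only: matching_stage.simps)
qed

lemma chi_diag: "chi diag = diagF listing"
proof
  fix z
  have "z \<in> diag \<longleftrightarrow> (\<exists>p\<in>{(x, s, c). x < s \<and> z = pr (pr x s) c}.
      snd (snd p) = diag_colour listing (fst p) (fst (snd p)))"
    by (auto simp: diag_def)
  then show "chi diag z = diagF listing z" unfolding chi_def diagF_def by simp
qed

lemma red_diag: "red (chi diag) listing"
proof (rule redI[of _ ODiag])
  show "chi diag = ev ODiag listing" by (simp add: chi_diag)
  have "loc (\<lambda>H. diagF H z) listing" for z
  proof -
    let ?A = "{(x, s, c). x < s \<and> z = pr (pr x s) c}"
    \<comment> \<open>Injectivity of \<open>pr\<close> leaves at most one way to decode
      \<open>z\<close>.\<close>
    have "?A \<subseteq> {p}" if "p \<in> ?A" for p using that by auto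
    then have fin: "finite ?A" by (metis (lifting) all_not_in_conv finite.emptyI finite_subset finite.insertI)
    have "loc (\<lambda>H. snd (snd p) = diag_colour H (fst p) (fst (snd p))) listing" for p :: "nat \<times> nat \<times> nat"
      unfolding diag_colour_def
      by (rule loc_fun[OF loc_matching_stage,
            where g = "\<lambda>c. snd (snd p) = to_nat (fst (snd p), snd c (fst p))"])
    then have "loc (\<lambda>H. \<exists>p\<in>?A. snd (snd p) = diag_colour H (fst p) (fst (snd p))) listing"
      by (intro loc_bex[OF fin])
    then show ?thesis unfolding diagF_def by (rule loc_fun[where g = "\<lambda>b. if b then 1 else 0"])
  qed
  then show "cont (ev ODiag) listing" by (simp add: cont_def)
qed

text \<open>The easy half of the limit lemma: each entry of the approximation changes at most once,
  from 0 to 1, so initial segments settle.\<close>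

lemma jump_stage_converges: "\<exists>s0. \<forall>s\<ge>s0. agree k (jump listing) (jump_stage listing s)"
proof (induction k)
  case 0
  then show ?case by (simp add: agree_def)
next
  case (Suc k)
  then obtain s0 where s0: "\<And>s. s0 \<le> s \<Longrightarrow> agree k (jump listing) (jump_stage listing s)" by blast
  obtain t :: opterm and n :: nat where tn: "from_nat k = (t, n)" by fastforce
  let ?P = "\<lambda>l. listing (to_nat (t, n, map listing [0..<l])) = 1"
  have "\<exists>s1. \<forall>s\<ge>s1. jump_stage listing s k = jump listing k"
  proof (cases "\<exists>l. ?P l")
    case True
    then obtain l where "?P l" by blast
    then have "jump_stage listing s k = jump listing k" if "Suc l \<le> s" for s
      using that unfolding jump_stage_def jump_def tn prod.case by (metis Suc_le_lessD)
    then show ?thesis by blast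
  next
    case False
    then have "jump_stage listing s k = jump listing k" for s
      unfolding jump_stage_def jump_def tn prod.case by (simp only: simp_thms if_False not_ex not_all)
    then show ?thesis by blast
  qed
  then obtain s1 where s1: "\<And>s. s1 \<le> s \<Longrightarrow> jump_stage listing s k = jump listing k" by blast
  have "agree (Suc k) (jump listing) (jump_stage listing s)" if "max s0 s1 \<le> s" for s
    using s0[of s] s1[of s] that by (auto simp: agree_def less_Suc_eq)
  then show ?case by blast
qed

text \<open>Once the approximation is correct on the part of the jump that determines the value at
  \<open>x\<close>, that part forces the value 1 for members, while for nonmembers no part of the
  approximation can force it.\<close>

lemma guessed_converges:
  assumes "chi R = ev t (jump listing)" "cont (ev t) (jump listing)"
  shows "\<exists>s0. \<forall>s\<ge>s0. guessed listing (to_nat t) s x \<longleftrightarrow> x \<in> R"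
proof -
  obtain k where k: "\<And>Q. agree k (jump listing) Q \<Longrightarrow> ev t Q x = ev t (jump listing) x"
    using assms(2) unfolding cont_def loc_def by blast
  obtain s0 where s0: "\<And>s. s0 \<le> s \<Longrightarrow> agree k (jump listing) (jump_stage listing s)"
    using jump_stage_converges by blast
  have "guessed listing (to_nat t) s x \<longleftrightarrow> x \<in> R" if "max s0 (Suc k) \<le> s" for s
  proof -
    have agree: "agree k (jump listing) (jump_stage listing s)" using s0 that by simp
    have val: "ev t Q x = 1 \<longleftrightarrow> x \<in> R" if "agree k (jump listing) Q" for Q
      using k[OF that] by (simp flip: assms(1))
    show ?thesis
    proof
      assume "guessed listing (to_nat t) s x"
      then obtain l where "listing (to_nat (t, x, map (jump_stage listing s) [0..<l])) = 1"
        by (auto simp: guessed_def)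
      then have "ev t (jump_stage listing s) x = 1" unfolding listing_iff using agree_refl by blast
      then show "x \<in> R" using val[OF agree] by blast
    next
      assume "x \<in> R"
      then have "ev t Q x = 1" if "agree k (jump_stage listing s) Q" for Q
        using val[of Q] agree that by (simp add: agree_def)
      then have "listing (to_nat (t, x, map (jump_stage listing s) [0..<k])) = 1" unfolding listing_iff by blast
      moreover have "k < s" using that by simp
      ultimately show "guessed listing (to_nat t) s x" unfolding guessed_def from_nat_to_nat by blast
    qed
  qed
  then show ?thesis by blast
qed

lemma guessed_converges_below:
  assumes "chi R = ev t (jump listing)" "cont (ev t) (jump listing)"
  shows "\<exists>s0. \<forall>s\<ge>s0. \<forall>x<N. guessed listing (to_nat t) s x \<longleftrightarrow> x \<in> R"
proof (induction N)
  case (Suc N)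
  then obtain s0 s1 where "\<forall>s\<ge>s0. \<forall>x<N. guessed listing (to_nat t) s x \<longleftrightarrow> x \<in> R"
    "\<forall>s\<ge>s1. guessed listing (to_nat t) s N \<longleftrightarrow> N \<in> R"
    using guessed_converges[OF assms] by blast
  then show ?case by (intro exI[of _ "max s0 s1"]) (auto simp: less_Suc_eq)
qed simp

lemma unbounded_infinite: "unbounded R \<Longrightarrow> infinite R"
  unfolding unbounded_def finite_nat_set_iff_bounded_le by (meson not_le)

text \<open>The functional computing \<open>R\<close> from the jump has an index \<open>e\<close>,
  which at every late stage \<open>s\<close> matches two small elements of \<open>R\<close>. Taking
  \<open>s\<close> in \<open>R\<close> gives two pairs inside \<open>R\<close> with the same
  colour.\<close>

lemma no_rainbow_diag:
  assumes "unbounded R" "red (chi R) (jump listing)"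
  shows "\<not> rainbow diag R"
proof
  assume rb: "rainbow diag R"
  obtain t where t: "chi R = ev t (jump listing)" "cont (ev t) (jump listing)"
    using assms(2) unfolding red_def by blast
  define e where "e = to_nat t"
  obtain B where B: "B \<subseteq> R" "finite B" "card B = 2 * e + 2"
    using infinite_arbitrarily_large[OF unbounded_infinite[OF assms(1)]] by blast
  define N where "N = Suc (Max B)"
  have BN: "B \<subseteq> R \<inter> {..<N}" using B unfolding N_def by (auto simp: less_Suc_eq_le)
  obtain s0 where s0: "\<And>s x. s0 \<le> s \<Longrightarrow> x < N \<Longrightarrow> guessed listing e s x \<longleftrightarrow> x \<in> R"
    using guessed_converges_below[OF t] unfolding e_def by blast
  \<comment> \<open>Beyond \<open>s0\<close> the guesses below \<open>N\<close> are correct, beyond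
    \<open>N\<close> the matched numbers lie below \<open>s\<close>, and beyond \<open>e\<close> the
    index \<open>e\<close> acts at stage \<open>s\<close>.\<close>
  obtain s where s: "max s0 (max N e) < s" "s \<in> R"
    using assms(1) unfolding unbounded_def by blast
  let ?c = "matching_stage listing s e"
  let ?G = "{x\<in>{..<s}. guessed listing e s x}"
  have G: "x \<in> ?G \<longleftrightarrow> x \<in> R" if "x < N" for x using that s0[of s x] s by simp
  \<comment> \<open>Earlier indices have matched at most \<open>2 * e\<close> numbers, so two of the
    \<open>2 * e + 2\<close> elements of \<open>B\<close> are free.\<close>
  have "card (B - fst ?c) \<ge> 2"
    using diff_card_le_card_Diff[of "fst ?c" B] matching_stage_matching[of listing s e] card_matching_stage[of listing s e] B(3)
    unfolding matching_def by linarith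
  moreover have "B - fst ?c \<subseteq> (?G - fst ?c) \<inter> {..<N}" using BN G by blast
  then have "card (B - fst ?c) \<le> card ((?G - fst ?c) \<inter> {..<N})" by (intro card_mono) auto
  ultimately have two: "2 \<le> card ((?G - fst ?c) \<inter> {..<N})" by linarith
  have fin: "finite ?G" by simp
  show False
    using fin
  proof (cases rule: addpair_cases[of ?G ?c])
    case 1
    have "card ((?G - fst ?c) \<inter> {..<N}) \<le> card (?G - fst ?c)" by (intro card_mono) auto
    then show False using two 1 by linarith
  next
    case (2 a b)
    have ab: "a < N" "b < N" using 2(5)[OF two] by auto
    have R: "a \<in> R" "b \<in> R" using 2(2,3) G ab by blast+
    have m: "matching_stage listing s (Suc e) = (fst ?c \<union> {a, b}, (snd ?c)(b := a))" using 2(1) by simp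
    have "snd ?c a = a" using 2(2) matching_stage_matching[of listing s e] unfolding matching_def by blast
    then have "snd (matching_stage listing s (Suc e)) a = snd (matching_stage listing s (Suc e)) b" using 2(4) unfolding m by simp
    moreover have "a \<in> fst (matching_stage listing s (Suc e))" "b \<in> fst (matching_stage listing s (Suc e))" unfolding m by simp_all
    ultimately have "snd (matching_stage listing s s) a = snd (matching_stage listing s s) b"
      using matching_stage_mono[of a listing s "Suc e" s] matching_stage_mono[of b listing s "Suc e" s] s(1) by simp
    then have "diag_colour listing a s = diag_colour listing b s" by (simp add: diag_colour_def)
    then have "pr (pr a s) (diag_colour listing a s) \<in> diag" "pr (pr b s) (diag_colour listing a s) \<in> diag"
      using ab s(1) by simp_all
    moreover have "a < s" "b < s" using ab s(1) by simp_all
    ultimately have "a = b" using rb R s(2) unfolding rainbow_def by blast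
    then show False using 2(4) by blast
  qed
qed

section \<open>Bushy trees\<close>

lemma Big_mono: "Big k A \<sigma> \<Longrightarrow> A \<subseteq> B \<Longrightarrow> Big k B \<sigma>"
  by (induction rule: Big.induct) (auto intro: Big.intros)

text \<open>Pigeonhole at each node: the required number of children is linear in the bushiness, so
  one of the two sets keeps its share.\<close>

lemma Big_Un:
  "Big (j + k) (A \<union> B) \<sigma> \<Longrightarrow> Big j A \<sigma> \<or> Big k B \<sigma>"
proof (induction rule: Big.induct)
  case (leaf \<sigma>)
  then show ?case by (auto intro: Big.leaf)
next
  case (node D \<sigma>)
  let ?A = "{a\<in>D. Big j A (\<sigma> @ [a])}"
  let ?B = "{a\<in>D. Big k B (\<sigma> @ [a])}"
  have "D = ?A \<union> ?B" using node.IH by blast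
  then have "card D \<le> card ?A + card ?B" by (metis (lifting) card_Un_le)
  then have "j * (2 * length \<sigma> + 1) \<le> card ?A \<or> k * (2 * length \<sigma> + 1) \<le> card ?B"
    using node.hyps(2) by (simp only: add_mult_distrib) linarith
  moreover have "finite ?A" "finite ?B" using node.hyps(1) by simp_all
  ultimately show ?case using Big.node[of ?A j \<sigma> A] Big.node[of ?B k \<sigma> B] by blast
qed

text \<open>Trees of the same bushiness are grafted onto the leaves of the first tree.\<close>

lemma Big_Big: "Big k {\<tau>. Big k B \<tau>} \<sigma> \<Longrightarrow> Big k B \<sigma>"
  by (induction rule: Big.induct) (auto intro: Big.intros)

text \<open>At a node that is not big for \<open>B\<close>, some child in the tree is not big
  either; following such children ends at a leaf in \<open>A\<close>.\<close>

lemma Big_escape: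
  "Big k A \<sigma> \<Longrightarrow> \<not> Big k B \<sigma> \<Longrightarrow> \<exists>\<tau>. prefix \<sigma> \<tau> \<and> \<tau> \<in> A \<and> \<not> Big k B \<tau>"
proof (induction rule: Big.induct)
  case (node D \<sigma>)
  then obtain a where "a \<in> D" "\<not> Big k B (\<sigma> @ [a])" using Big.node by blast
  with node.IH obtain \<tau> where "prefix (\<sigma> @ [a]) \<tau>" "\<tau> \<in> A" "\<not> Big k B \<tau>" by blast
  then show ?case by (meson append_prefixD)
qed blast

lemma Big_grow: "\<not> Big k B \<sigma> \<Longrightarrow> \<exists>a. \<not> Big k B (\<sigma> @ [a])"
  using Big.node[of "{..<k * (2 * length \<sigma> + 1)}" k \<sigma> B] by auto

lemma not_Big_empty: "Big k {} \<sigma> \<Longrightarrow> k = 0"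
proof (induction rule: Big.induct)
  case (node D \<sigma>)
  then show ?case by (cases "D = {}") auto
qed simp

text \<open>Inductively generated trees with finite branching have finitely many leaves. Hence
  bigness is an existential quantifier over a continuous relation.\<close>

lemma Big_finite:
  assumes "Big k B \<sigma>"
  shows "\<exists>t. Big k {\<tau>\<in>B. to_nat \<tau> < t} \<sigma>"
  using assms
proof (induction rule: Big.induct)
  case (leaf \<sigma>)
  then have "\<sigma> \<in> {\<tau>\<in>B. to_nat \<tau> < Suc (to_nat \<sigma>)}" by simp
  then show ?case by (blast intro: Big.leaf)
next
  case (node D \<sigma>)
  then obtain f where f: "\<And>a. a \<in> D \<Longrightarrow> Big k {\<tau>\<in>B. to_nat \<tau> < f a} (\<sigma> @ [a])" by metis
  have "Big k {\<tau>\<in>B. to_nat \<tau> < Max (f ` D)} (\<sigma> @ [a])" if "a \<in> D" for a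
  proof (rule Big_mono[OF f[OF that]])
    have "f a \<le> Max (f ` D)" using node.hyps(1) that by simp
    then show "{\<tau>\<in>B. to_nat \<tau> < f a} \<subseteq> {\<tau>\<in>B. to_nat \<tau> < Max (f ` D)}" by auto
  qed
  then show ?case using Big.node[OF node.hyps(1,2)] by blast
qed

text \<open>Separates the forcing construction from the origin of its three columns.
  \<open>C q\<close> stands for the strings that answer query \<open>q\<close> positively.\<close>

locale bushy =
  fixes P :: orc and C :: "nat \<Rightarrow> nat list set" and sim :: "nat \<Rightarrow> nat \<Rightarrow> bool"
  assumes isbig: "isbig P k E \<sigma> \<longleftrightarrow> Big k (\<Union>q\<in>set E. C q) \<sigma>"
    and col2: "lft (rgt P) (to_nat (q, \<tau>)) = 1 \<longleftrightarrow> \<tau> \<in> C q"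
    and col3: "rgt (rgt P) (to_nat (x, y)) = 1 \<longleftrightarrow> sim x y"
    and C_mono: "\<tau> \<in> C q \<Longrightarrow> prefix \<tau> \<tau>' \<Longrightarrow> \<tau>' \<in> C q"
    and sim_refl: "sim x x"
    and sim_card: "finite {a. sim x a}" "card {a. sim x a} \<le> 2"
begin

abbreviation B :: "nat list \<Rightarrow> nat list set" where
  "B E \<equiv> \<Union>q\<in>set E. C q"

lemma good_iff: "good P \<tau> \<longleftrightarrow> (\<forall>j<length \<tau>. \<forall>i<j. \<not> sim (\<tau> ! i) (\<tau> ! j))"
  unfolding good_def col3 ..

lemma good_snoc: "good P (\<sigma> @ [a]) \<longleftrightarrow> good P \<sigma> \<and> (\<forall>x\<in>set \<sigma>. \<not> sim x a)"
  unfolding good_iff by (auto simp: less_Suc_eq nth_append all_set_conv_all_nth)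

lemma card_bad:
  fixes \<sigma> :: "nat list"
  shows "finite (\<Union>x\<in>set \<sigma>. {a. sim x a}) \<and> card (\<Union>x\<in>set \<sigma>. {a. sim x a}) \<le> 2 * length \<sigma>"
proof (induction \<sigma>)
  case (Cons y \<sigma>)
  let ?U = "\<Union>x\<in>set \<sigma>. {a. sim x a}"
  have "card ({a. sim y a} \<union> ?U) \<le> card {a. sim y a} + card ?U" by (rule card_Un_le)
  then show ?case using Cons sim_card[of y] by simp
qed simp

text \<open>An inner node has more children than the at most \<open>2 * length \<sigma>\<close>
  numbers equivalent to one of its entries, so goodness passes to some child.\<close>

lemma not_Big_bad: "Big 1 {\<tau>. \<not> good P \<tau>} \<sigma> \<Longrightarrow> \<not> good P \<sigma>"
proof (induction rule: Big.induct)
  case (node D \<sigma>)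
  let ?U = "\<Union>x\<in>set \<sigma>. {a. sim x a}"
  show ?case
  proof
    assume g: "good P \<sigma>"
    have "D \<subseteq> ?U" using node.IH g unfolding good_snoc by blast
    then have "card D \<le> 2 * length \<sigma>" using card_bad[of \<sigma>] card_mono[of ?U D] by linarith
    then show False using node.hyps(2) by simp
  qed
qed simp

definition inv :: "nat list \<times> nat list \<Rightarrow> bool" where
  "inv c \<longleftrightarrow> good P (fst c) \<and> \<not> Big (length (snd c) + 1) (B (snd c)) (fst c)"

text \<open>Of the bushiness, one unit pays for pairwise inequivalence and the rest contradicts the
  invariant, after \<open>Big_Big\<close> has removed the nested bigness.\<close>

lemma not_Big_inv:
  assumes "inv c"
  shows "\<not> Big (length (snd c) + 2) ({\<tau>. \<not> good P \<tau>} \<union> {\<tau>. Big (length (snd c) + 1) (B (snd c)) \<tau>}) (fst c)"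
proof
  assume b: "Big (length (snd c) + 2) ({\<tau>. \<not> good P \<tau>} \<union> {\<tau>. Big (length (snd c) + 1) (B (snd c)) \<tau>}) (fst c)"
  have "length (snd c) + 2 = 1 + (length (snd c) + 1)" by simp
  then have "Big (1 + (length (snd c) + 1)) ({\<tau>. \<not> good P \<tau>} \<union> {\<tau>. Big (length (snd c) + 1) (B (snd c)) \<tau>}) (fst c)"
    using b by (simp only:)
  then have "Big 1 {\<tau>. \<not> good P \<tau>} (fst c) \<or> Big (length (snd c) + 1) (B (snd c)) (fst c)"
    using Big_Un Big_Big by blast
  then show False using assms not_Big_bad unfolding inv_def by blast
qed

text \<open>The escaping string answers \<open>n\<close> or an older query. It is not big for the
  older queries, so it answers none of them and must answer \<open>n\<close>.\<close>

lemma ex_cand: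
  assumes "inv c" "yes P n c"
  shows "\<exists>i. cand P n c (from_nat i)"
proof -
  have "Big (length (snd c) + 2) (C n \<union> B (snd c)) (fst c)"
    using assms(2) unfolding yes_def isbig by simp
  then obtain \<tau> where \<tau>: "prefix (fst c) \<tau>" "\<tau> \<in> C n \<union> B (snd c)"
    and nb: "\<not> Big (length (snd c) + 2)
      ({\<tau>. \<not> good P \<tau>} \<union> {\<tau>. Big (length (snd c) + 1) (B (snd c)) \<tau>}) \<tau>"
    using Big_escape[OF _ not_Big_inv[OF assms(1)]] by metis
  have "\<tau> \<notin> {\<tau>. \<not> good P \<tau>} \<union> {\<tau>. Big (length (snd c) + 1) (B (snd c)) \<tau>}"
    using nb by (rule contrapos_nn) (rule Big.leaf)
  then have g: "good P \<tau>" and s: "\<not> Big (length (snd c) + 1) (B (snd c)) \<tau>" by blast+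
  have "\<tau> \<notin> B (snd c)" using s by (rule contrapos_nn) (rule Big.leaf)
  then have "\<tau> \<in> C n" using \<tau>(2) by blast
  then have "cand P n c \<tau>" unfolding cand_def isbig col2 using \<tau>(1) g s by blast
  then show ?thesis by (intro exI[of _ "to_nat \<tau>"]) simp
qed

lemma decide_yes:
  assumes "inv c" "yes P n c"
  shows "cand P n c (fst (decide P n c)) \<and> snd (decide P n c) = snd c"
  using LeastI_ex[OF ex_cand[OF assms]] assms(2) unfolding decide_def by simp

lemma inv_decide:
  assumes "inv c"
  shows "inv (decide P n c) \<and> prefix (fst c) (fst (decide P n c))"
proof (cases "yes P n c")
  case True
  then show ?thesis using decide_yes[OF assms True] unfolding inv_def cand_def isbig by simp
next
  case False
  then have "\<not> Big (length (snd c) + 2) (B (n # snd c)) (fst c)" unfolding yes_def isbig .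
  then show ?thesis using assms False unfolding inv_def decide_def by simp
qed

text \<open>Deciding a query need not lengthen the string; this extra extension makes the limit
  sequence total.\<close>

lemma ex_grows:
  assumes "inv c"
  shows "\<exists>a. grows P c a"
proof -
  obtain a where a: "\<not> Big (length (snd c) + 2)
      ({\<tau>. \<not> good P \<tau>} \<union> {\<tau>. Big (length (snd c) + 1) (B (snd c)) \<tau>}) (fst c @ [a])"
    using Big_grow[OF not_Big_inv[OF assms]] by blast
  have "fst c @ [a] \<notin> {\<tau>. \<not> good P \<tau>} \<union> {\<tau>. Big (length (snd c) + 1) (B (snd c)) \<tau>}"
    using a by (rule contrapos_nn) (rule Big.leaf)
  then show ?thesis unfolding grows_def isbig by blast
qed

lemma inv_extend:
  assumes "inv c"
  shows "inv (extend P c) \<and> prefix (fst c) (fst (extend P c)) \<and>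
    length (fst (extend P c)) = Suc (length (fst c)) \<and> snd (extend P c) = snd c"
  using LeastI_ex[OF ex_grows[OF assms]] unfolding grows_def isbig inv_def extend_def by simp

lemma inv_stage: "inv (stage P n)"
proof (induction n)
  case 0
  then show ?case using not_Big_empty[of 1 "[]"] by (auto simp: inv_def good_iff)
next
  case (Suc n)
  then show ?case using inv_decide inv_extend by simp
qed

lemma stage_Suc:
  "prefix (fst (decide P n (stage P n))) (fst (stage P (Suc n)))"
  "prefix (fst (stage P n)) (fst (stage P (Suc n)))"
  "length (fst (stage P n)) < length (fst (stage P (Suc n)))"
  "snd (stage P (Suc n)) = snd (decide P n (stage P n))"
proof -
  note d = inv_decide[OF inv_stage[of n], of n]
  note e = inv_extend[OF conjunct1[OF d]]
  show "prefix (fst (decide P n (stage P n))) (fst (stage P (Suc n)))" using e by simp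
  show "prefix (fst (stage P n)) (fst (stage P (Suc n)))"
    using prefix_order.trans[OF conjunct2[OF d] conjunct1[OF conjunct2[OF e]]] by simp
  have "length (fst (stage P n)) \<le> length (fst (decide P n (stage P n)))"
    using d by (simp add: prefix_length_le)
  then show "length (fst (stage P n)) < length (fst (stage P (Suc n)))" using e by simp
  show "snd (stage P (Suc n)) = snd (decide P n (stage P n))" using e by simp
qed

lemma stage_prefix: "m \<le> n \<Longrightarrow> prefix (fst (stage P m)) (fst (stage P n))"
proof (induction rule: dec_induct)
  case (step n)
  then show ?case using stage_Suc(2)[of n] prefix_order.trans by blast
qed simp

lemma stage_length: "n \<le> length (fst (stage P n))"
proof (induction n)
  case (Suc n)
  then show ?case using stage_Suc(3)[of n] by linarith
qed simp

lemma stage_neg: "m \<le> n \<Longrightarrow> q \<in> set (snd (stage P m)) \<Longrightarrow> q \<in> set (snd (stage P n))"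
proof (induction rule: dec_induct)
  case (step n)
  then show ?case unfolding stage_Suc(4) decide_def by auto
qed simp

definition G :: "nat \<Rightarrow> nat" where
  "G i = fst (stage P (Suc i)) ! i"

lemma G_nth:
  assumes "i < length (fst (stage P n))"
  shows "G i = fst (stage P n) ! i"
proof -
  have "i < length (fst (stage P (Suc i)))" using stage_length[of "Suc i"] by simp
  then show ?thesis
    using stage_prefix[of "Suc i" n] stage_prefix[of n "Suc i"] assms
    unfolding G_def prefix_def by (metis nat_le_linear nth_append)
qed

lemma G_map: "map G [0..<length (fst (stage P n))] = fst (stage P n)"
  using G_nth by (intro nth_equalityI) auto

lemma G_sim: "i < j \<Longrightarrow> \<not> sim (G i) (G j)"
proof -
  assume "i < j"
  have j: "j < length (fst (stage P (Suc j)))" using stage_length[of "Suc j"] by simp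
  have "good P (fst (stage P (Suc j)))" using inv_stage unfolding inv_def by blast
  then show ?thesis
    using G_nth[OF j] G_nth[of i "Suc j"] \<open>i < j\<close> j unfolding good_iff by simp
qed

text \<open>A positive answer is realized by the string chosen at stage \<open>q\<close>. After a
  negative answer \<open>q\<close> stays listed, and a later initial segment in \<open>C q\<close>
  would be a one-node big tree, against the invariant.\<close>

lemma jumpF_iff: "jumpF P q = 1 \<longleftrightarrow> (\<exists>m. map G [0..<m] \<in> C q)"
proof (cases "yes P q (stage P q)")
  case True
  let ?d = "decide P q (stage P q)"
  have "fst ?d \<in> C q"
    using decide_yes[OF inv_stage True] unfolding cand_def col2 by blast
  then have "fst (stage P (Suc q)) \<in> C q" using stage_Suc(1) C_mono by blast
  then have "map G [0..<length (fst (stage P (Suc q)))] \<in> C q" unfolding G_map .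
  then show ?thesis using True unfolding jumpF_def by auto
next
  case False
  have "snd (stage P (Suc q)) = q # snd (stage P q)"
    using False unfolding stage_Suc(4) decide_def by simp
  then have q: "q \<in> set (snd (stage P (Suc q)))" by simp
  have "map G [0..<m] \<notin> C q" for m
  proof
    assume m: "map G [0..<m] \<in> C q"
    \<comment> \<open>From stage \<open>Suc q\<close> on the query is listed, and by stage
      \<open>m\<close> the string has length at least \<open>m\<close>.\<close>
    let ?n = "max (Suc q) m"
    let ?s = "stage P ?n"
    have "prefix (map G [0..<m]) (map G [0..<length (fst ?s)])"
      using stage_length[of ?n] by (intro map_mono_prefix) (metis le_add_diff_inverse max.bounded_iff prefixI upt_add_eq_append zero_le)
    then have "fst ?s \<in> C q" using C_mono[OF m] unfolding G_map by blast
    moreover have "q \<in> set (snd ?s)" using stage_neg[OF _ q] by simp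
    ultimately have "fst ?s \<in> B (snd ?s)" by blast
    then have "Big (length (snd ?s) + 1) (B (snd ?s)) (fst ?s)" by (rule Big.leaf)
    then show False using inv_stage unfolding inv_def by blast
  qed
  then show ?thesis using False unfolding jumpF_def by simp
qed

section \<open>Local constancy of the forcing construction\<close>

lemma loc_isbig: "loc (\<lambda>Q. isbig Q k E \<sigma>) R"
  unfolding isbig_def by (rule loc_fun[OF loc_lft, where g = "\<lambda>a. a = 1"])

lemma loc_good: "loc (\<lambda>Q. good Q \<tau>) R"
  unfolding good_def
proof (intro loc_all_less)
  fix i j
  show "loc (\<lambda>Q. rgt (rgt Q) (to_nat (\<tau> ! i, \<tau> ! j)) \<noteq> 1) R"
    unfolding rgt_def by (rule loc_fun[OF loc_app, where g = "\<lambda>a. a \<noteq> 1"])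
qed

lemma loc_cand: "loc (\<lambda>Q. cand Q n c \<tau>) R"
proof -
  have 1: "loc (\<lambda>Q. lft (rgt Q) (to_nat (n, \<tau>)) = 1) R"
    unfolding lft_def rgt_def by (rule loc_fun[OF loc_app, where g = "\<lambda>a. a = 1"])
  have 2: "loc (\<lambda>Q. \<not> isbig Q (length (snd c) + 1) (snd c) \<tau>) R"
    by (rule loc_fun[OF loc_isbig, where g = Not])
  show ?thesis unfolding cand_def
    by (rule loc_conj[OF loc_const loc_conj[OF loc_good loc_conj[OF 2 1]]])
qed

lemma loc_grows: "loc (\<lambda>Q. grows Q c a) R"
proof -
  have "loc (\<lambda>Q. \<not> isbig Q (length (snd c) + 1) (snd c) (fst c @ [a])) R"
    by (rule loc_fun[OF loc_isbig, where g = Not])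
  then show ?thesis unfolding grows_def by (rule loc_conj[OF loc_good])
qed

text \<open>The search for a candidate matters only after a positive test at \<open>P\<close>, and
  there the invariant guarantees that it ends.\<close>

lemma loc_decide:
  assumes "inv c"
  shows "loc (\<lambda>Q. decide Q n c) P"
proof -
  have y: "loc (\<lambda>Q. yes Q n c) P" unfolding yes_def by (rule loc_isbig)
  have "loc (\<lambda>Q. (from_nat (LEAST i. cand Q n c (from_nat i)) :: nat list, snd c)) P"
    if "yes P n c"
  proof -
    obtain i where "cand P n c (from_nat i)" using ex_cand[OF assms \<open>yes P n c\<close>] by blast
    then have "loc (\<lambda>Q. LEAST i. cand Q n c (from_nat i)) P"
      by (rule loc_Least[where \<psi> = "\<lambda>i Q. cand Q n c (from_nat i)"]) (rule loc_cand)
    then show ?thesis by (rule loc_fun[where g = "\<lambda>i. (from_nat i, snd c)"])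
  qed
  then show ?thesis unfolding decide_def by (rule loc_if[OF y _ loc_const])
qed

lemma loc_extend:
  assumes "inv c"
  shows "loc (\<lambda>Q. extend Q c) P"
proof -
  obtain a where "grows P c a" using ex_grows[OF assms] by blast
  then have "loc (\<lambda>Q. LEAST a. grows Q c a) P"
    by (rule loc_Least[where \<psi> = "\<lambda>a Q. grows Q c a"]) (rule loc_grows)
  then show ?thesis unfolding extend_def by (rule loc_fun[where g = "\<lambda>a. (fst c @ [a], snd c)"])
qed

lemma loc_stage: "loc (\<lambda>Q. stage Q n) P"
proof (induction n)
  case 0
  then show ?case by (simp add: loc_const)
next
  case (Suc n)
  then have "loc (\<lambda>Q. decide Q n (stage Q n)) P"
    by (rule loc_bind[where \<psi> = "\<lambda>c Q. decide Q n c"]) (rule loc_decide[OF inv_stage])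
  then have "loc (\<lambda>Q. extend Q (decide Q n (stage Q n))) P"
    by (rule loc_bind[where \<psi> = "\<lambda>c Q. extend Q c"])
      (rule loc_extend[OF conjunct1[OF inv_decide[OF inv_stage]]])
  then show ?case by (simp only: stage.simps)
qed

lemma cont_jumpF: "cont jumpF P"
  unfolding cont_def
proof
  fix n
  have "loc (\<lambda>Q. if yes Q n (stage Q n) then 1 else 0 :: nat) P"
    using loc_stage
  proof (rule loc_bind[where \<psi> = "\<lambda>c Q. if yes Q n c then 1 else 0"])
    show "loc (\<lambda>Q. if yes Q n (stage P n) then 1 else 0 :: nat) P"
      unfolding yes_def by (rule loc_fun[OF loc_isbig, where g = "\<lambda>b. if b then 1 else 0"])
  qed
  then show "loc (\<lambda>Q. jumpF Q n) P" unfolding jumpF_def .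
qed

end

section \<open>Rainbows for weakly rainbow-stable colourings\<close>

definition weakly_stable :: "nat set \<Rightarrow> bool" where
  "weakly_stable A \<longleftrightarrow> (\<forall>x y.
    (\<exists>b. \<forall>s>b. \<exists>c. pr (pr x s) c \<in> A \<and> pr (pr y s) c \<in> A) \<or>
    (\<exists>b. \<forall>s>b. \<exists>c d. pr (pr x s) c \<in> A \<and> pr (pr y s) d \<in> A \<and> c \<noteq> d))"

locale weakly_stable_colouring =
  fixes A :: "nat set"
  assumes col: "colouring A" and two: "bounded2 A" and weak: "weakly_stable A"
begin

abbreviation g :: "nat \<Rightarrow> nat \<Rightarrow> nat" where
  "g x s \<equiv> colour (chi A) x s"

lemma mem_iff: "pr (pr x s) c \<in> A \<longleftrightarrow> x < s \<and> c = g x s"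
proof -
  have "x < s" if "pr (pr x s) c \<in> A" for c
    using col that unfolding colouring_def by fastforce
  moreover have "pr (pr x s) c \<in> A \<longleftrightarrow> c = g x s" if xs: "x < s"
  proof -
    have "\<exists>d. pr (pr x s) d \<in> A \<and> (\<forall>c. pr (pr x s) c \<in> A \<longrightarrow> c = d)"
      using conjunct2[OF col[unfolded colouring_def]] xs by simp
    then obtain d where d: "pr (pr x s) d \<in> A" "\<forall>c. pr (pr x s) c \<in> A \<longrightarrow> c = d"
      by (elim exE conjE)
    then have iff: "pr (pr x s) c \<in> A \<longleftrightarrow> c = d" for c by blast
    have "g x s = d" unfolding colour_def by (rule Least_equality) (simp_all add: iff)
    then show ?thesis using iff by simp
  qed
  ultimately show ?thesis by blast
qed

lemma bounded: "g x s = g y t \<Longrightarrow> g y t = g z u \<Longrightarrow> x < s \<Longrightarrow> y < t \<Longrightarrow> z < u \<Longrightarrow>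
  (x = y \<and> s = t) \<or> (x = z \<and> s = u) \<or> (y = z \<and> t = u)"
  using two[unfolded bounded2_def, rule_format, of "pr x s" "g x s" "pr y t" "pr z u"]
  unfolding mem_iff by simp

definition sim :: "nat \<Rightarrow> nat \<Rightarrow> bool" where
  "sim x y \<longleftrightarrow> (\<exists>b. \<forall>s>b. x < s \<and> y < s \<and> g x s = g y s)"

lemma stable: "sim x y \<or> (\<exists>b. \<forall>s>b. x < s \<and> y < s \<and> g x s \<noteq> g y s)"
  using weak[unfolded weakly_stable_def, rule_format, of x y] unfolding mem_iff sim_def by blast

lemma sim_refl: "sim x x"
  unfolding sim_def by blast

text \<open>At a late \<open>s\<close>, three distinct equivalent numbers would give three pairs of
  one colour.\<close>

lemma sim_three: "sim x y \<Longrightarrow> sim x z \<Longrightarrow> x = y \<or> x = z \<or> y = z"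
proof -
  assume xy: "sim x y" and xz: "sim x z"
  obtain b where b: "\<forall>s>b. x < s \<and> y < s \<and> g x s = g y s"
    using xy unfolding sim_def by (elim exE)
  obtain c where c: "\<forall>s>c. x < s \<and> z < s \<and> g x s = g z s"
    using xz unfolding sim_def by (elim exE)
  define s where "s = Suc (max b c)"
  have "b < s" "c < s" unfolding s_def by simp_all
  then have "x < s \<and> y < s \<and> g x s = g y s" "x < s \<and> z < s \<and> g x s = g z s"
    using b c by blast+
  then show ?thesis using bounded[of y s x s z s] by argo
qed

lemma sim_card: "finite {a. sim x a} \<and> card {a. sim x a} \<le> 2"
proof (cases "{a. sim x a} \<subseteq> {x}")
  case True
  then show ?thesis using finite_subset[OF True] card_mono[OF _ True] by simp
next
  case False
  then obtain y where "sim x y" "y \<noteq> x" by blast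
  then have *: "{a. sim x a} \<subseteq> {x, y}" using sim_three by blast
  moreover have "card {x, y} \<le> 2" by (simp add: card_insert_if)
  ultimately show ?thesis using finite_subset[OF *] card_mono[OF _ *] by simp
qed

section \<open>Deciding the equivalence with one jump\<close>

lemma loc_colour: "x < s \<Longrightarrow> loc (\<lambda>P. colour P x s) (chi A)"
  unfolding colour_def
proof (rule loc_Least[where \<psi> = "\<lambda>c P. P (pr (pr x s) c) = 1" and i = "g x s"])
  show "chi A (pr (pr x s) (g x s)) = 1" if "x < s" using that by (simp add: mem_iff)
  show "loc (\<lambda>P. P (pr (pr x s) c) = 1) (chi A)" for c
    by (rule loc_fun[OF loc_app, where g = "\<lambda>a. a = 1"])
qed

lemma loc_colours:
  assumes "x < s" "y < t"
  shows "loc (\<lambda>P. h (colour P x s) (colour P y t)) (chi A)"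
  using loc_colour[OF assms(1)] loc_colour[OF assms(2)] by (rule loc_fun2)

lemma cont_pairs:
  fixes h :: "nat \<Rightarrow> nat \<Rightarrow> bool"
  shows "loc (\<lambda>P. if b < t \<and> \<not> (x < t \<and> y < t \<and> h (colour P x t) (colour P y t)) then 1 else 0 :: nat) (chi A)"
proof (cases "x < t \<and> y < t")
  case True
  then show ?thesis
    using loc_colours[of x t y t "\<lambda>c d. if b < t \<and> \<not> h c d then 1 else 0 :: nat"] by simp
next
  case False
  then have "(\<lambda>P. if b < t \<and> \<not> (x < t \<and> y < t \<and> h (colour P x t) (colour P y t)) then 1 else 0 :: nat) =
      (\<lambda>P. if b < t then 1 else 0)" by auto
  then show ?thesis by (simp only: loc_const)
qed

lemma red_neqF: "red (neqF (chi A)) (chi A)"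
proof (rule redI[of _ ONeq])
  have "loc (\<lambda>P. neqF P i) (chi A)" for i
  proof -
    obtain n t :: nat where i: "from_nat i = (n, t)" by fastforce
    obtain x y b :: nat where n: "from_nat n = (x, y, b)" by (metis prod_cases3)
    show ?thesis unfolding neqF_def i n prod.case by (rule cont_pairs)
  qed
  then show "cont (ev ONeq) (chi A)" by (simp add: cont_def)
qed simp

lemma red_equF: "red (equF (chi A)) (chi A)"
proof (rule redI[of _ OEqu])
  have "loc (\<lambda>P. equF P i) (chi A)" for i
  proof -
    obtain n t :: nat where i: "from_nat i = (n, t)" by fastforce
    obtain x y b :: nat where n: "from_nat n = (x, y, b)" by (metis prod_cases3)
    show ?thesis unfolding equF_def i n prod.case by (rule cont_pairs)
  qed
  then show "cont (ev OEqu) (chi A)" by (simp add: cont_def)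
qed simp

text \<open>The halves record which \<open>b\<close> fail as bounds for eventual equality and for
  eventual difference.\<close>

abbreviation S :: orc where
  "S \<equiv> join (sigm (neqF (chi A))) (sigm (equF (chi A)))"

lemma neq_iff: "sigm (neqF (chi A)) (to_nat (x, y, b)) \<noteq> 1 \<longleftrightarrow>
    (\<forall>s>b. x < s \<and> y < s \<and> g x s = g y s)"
  unfolding sigm_iff neqF_def by auto

lemma equ_iff: "sigm (equF (chi A)) (to_nat (x, y, b)) \<noteq> 1 \<longleftrightarrow>
    (\<forall>s>b. x < s \<and> y < s \<and> g x s \<noteq> g y s)"
  unfolding sigm_iff equF_def by auto

lemma ex_modulus:
  fixes x y :: nat
  shows "\<exists>b::nat. lft S (to_nat (x, y, b)) \<noteq> 1 \<or> rgt S (to_nat (x, y, b)) \<noteq> 1"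
  using stable[of x y]
proof
  assume "sim x y"
  then show ?thesis unfolding lft_join rgt_join neq_iff equ_iff sim_def by (elim exE) (rule exI, rule disjI1)
next
  assume "\<exists>b. \<forall>s>b. x < s \<and> y < s \<and> g x s \<noteq> g y s"
  then show ?thesis unfolding lft_join rgt_join neq_iff equ_iff by (elim exE) (rule exI, rule disjI2)
qed

text \<open>Weak stability supplies a bound of one of the two kinds. Both kinds would clash at a
  late \<open>s\<close>, so the first bound found decides the relation.\<close>

lemma simF_iff: "simF S (to_nat (x, y)) = 1 \<longleftrightarrow> sim x y"
proof -
  define b :: nat where "b = (LEAST b. lft S (to_nat (x, y, b)) \<noteq> 1 \<or> rgt S (to_nat (x, y, b)) \<noteq> 1)"
  have "lft S (to_nat (x, y, b)) \<noteq> 1 \<or> rgt S (to_nat (x, y, b)) \<noteq> 1"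
    unfolding b_def using LeastI_ex[OF ex_modulus] .
  then have b: "(\<forall>s>b. x < s \<and> y < s \<and> g x s = g y s) \<or> (\<forall>s>b. x < s \<and> y < s \<and> g x s \<noteq> g y s)"
    unfolding lft_join rgt_join neq_iff equ_iff .
  have "simF S (to_nat (x, y)) = 1 \<longleftrightarrow> lft S (to_nat (x, y, b)) \<noteq> 1"
    unfolding simF_def b_def Let_def by simp
  also have "\<dots> \<longleftrightarrow> (\<forall>s>b. x < s \<and> y < s \<and> g x s = g y s)"
    unfolding lft_join neq_iff ..
  also have "\<dots> \<longleftrightarrow> sim x y"
  proof
    assume "sim x y"
    then obtain c where c: "\<forall>s>c. x < s \<and> y < s \<and> g x s = g y s"
      unfolding sim_def by (elim exE)
    define s where "s = Suc (max b c)"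
    have "b < s" "c < s" unfolding s_def by simp_all
    then have "g x s = g y s" using c by blast
    then have "\<not> (\<forall>s>b. x < s \<and> y < s \<and> g x s \<noteq> g y s)" using \<open>b < s\<close> by blast
    then show "\<forall>s>b. x < s \<and> y < s \<and> g x s = g y s" using b by blast
  qed (unfold sim_def, blast)
  finally show ?thesis .
qed

lemma red_simF: "red (simF S) S"
proof (rule redI[of _ OSim])
  have "loc (\<lambda>P. simF P i) S" for i
  proof (cases "from_nat i :: nat \<times> nat")
    case (Pair x y)
    let ?h = "\<lambda>(b :: nat) P. lft P (to_nat (x, y, b)) \<noteq> 1 \<or> rgt P (to_nat (x, y, b)) \<noteq> 1"
    have "loc (?h b) S" for b
      using loc_lft loc_rgt by (rule loc_fun2[where g = "\<lambda>c d. c \<noteq> 1 \<or> d \<noteq> 1"])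
    moreover obtain b :: nat where "?h b S" using ex_modulus by blast
    ultimately have "loc (\<lambda>P. LEAST b. ?h b P) S"
      by (rule loc_Least[where \<psi> = ?h, rotated])
    then have "loc (\<lambda>P. if lft P (to_nat (x, y, LEAST b. ?h b P)) \<noteq> 1 then 1 else 0 :: nat) S"
      by (rule loc_bind[where \<psi> = "\<lambda>b P. if lft P (to_nat (x, y, b)) \<noteq> 1 then 1 else 0"])
        (rule loc_fun[OF loc_lft, where g = "\<lambda>c. if c \<noteq> 1 then 1 else 0"])
    then show ?thesis unfolding simF_def Pair prod.case Let_def .
  qed
  then show "cont (ev OSim) S" by (simp add: cont_def)
qed simp

lemma red_sim:
  assumes "red (chi A) X"
  shows "red (simF S) (jump X)"
  using red_trans[OF red_simF red_join[OF sigm_red_jump sigm_red_jump]]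
    red_trans[OF red_neqF assms] red_trans[OF red_equF assms] by blast

section \<open>Greedy thinning to a rainbow\<close>

context
  fixes G :: "nat \<Rightarrow> nat"
  assumes G: "\<And>i j. i < j \<Longrightarrow> \<not> sim (G i) (G j)"
begin

lemma inj_G: "inj G"
  using G sim_refl by (metis injI linorder_neqE_nat)

lemma finite_same:
  assumes "x \<in> range G" "y \<in> range G" "x \<noteq> y"
  shows "finite {s. x < s \<and> y < s \<and> g x s = g y s}"
proof -
  obtain i j where ij: "x = G i" "y = G j" "i \<noteq> j" using assms by blast
  have "\<exists>b. \<forall>s>b. g x s \<noteq> g y s"
  proof (cases "i < j")
    case True
    then show ?thesis using stable[of x y] G[of i j] unfolding ij by blast
  next
    case False
    then have "j < i" using ij(3) by simp
    then show ?thesis using stable[of y x] G[of j i] unfolding ij by fastforce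
  qed
  then obtain b where b: "\<forall>s>b. g x s \<noteq> g y s" by (elim exE)
  have "s \<le> b" if "g x s = g y s" for s
    using b that by (meson not_le)
  then have "{s. x < s \<and> y < s \<and> g x s = g y s} \<subseteq> {..b}" by blast
  then show ?thesis using finite_subset by blast
qed

lemma finite_colour: "finite {s. x < s \<and> g x s = c}"
proof (rule ccontr)
  assume "infinite {s. x < s \<and> g x s = c}"
  then obtain B where B: "finite B" "card B = 3" "B \<subseteq> {s. x < s \<and> g x s = c}"
    using infinite_arbitrarily_large by blast
  then obtain s t u where "B = {s, t, u}" "s \<noteq> t" "s \<noteq> u" "t \<noteq> u"
    unfolding card_3_iff by blast
  then show False using B(3) bounded[of x s x t x u] by auto
qed

lemma ex_rainbow_next:
  assumes "finite R" "R \<subseteq> range G" "rainbow_for (chi A) R"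
  shows "\<exists>i. rainbow_next (join (chi A) G) R (G i)"
proof -
  \<comment> \<open>To be avoided: numbers not above \<open>R\<close>, collisions between two new
    pairs, and collisions of a new pair with an old one. The second part is finite by inequivalence,
    the third because a colour recurs at most twice with a fixed lower end.\<close>
  define bad where "bad = (\<Union>x\<in>R. {..x}) \<union>
    (\<Union>x\<in>R. \<Union>y\<in>R - {x}. {s. x < s \<and> y < s \<and> g x s = g y s}) \<union>
    (\<Union>x\<in>R. \<Union>y\<in>R. \<Union>t\<in>R. {s. x < s \<and> g x s = g y t})"
  have "finite (\<Union>x\<in>R. \<Union>y\<in>R - {x}. {s. x < s \<and> y < s \<and> g x s = g y s})"
  proof (intro finite_UN_I finite_Diff assms(1))
    fix x y
    assume "x \<in> R" "y \<in> R - {x}"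
    then show "finite {s. x < s \<and> y < s \<and> g x s = g y s}"
      using assms(2) by (intro finite_same) blast+
  qed
  moreover have "finite (\<Union>x\<in>R. \<Union>y\<in>R. \<Union>t\<in>R. {s. x < s \<and> g x s = g y t})"
    by (intro finite_UN_I assms(1) finite_colour)
  ultimately have "finite bad"
    unfolding bad_def using assms(1) by simp
  moreover have "infinite (range G)" using finite_imageD[OF _ inj_G] infinite_UNIV_nat by blast
  ultimately obtain s where s: "s \<in> range G" "s \<notin> bad"
    by (meson finite_subset subsetI)
  have less: "x < s" if "x \<in> R" for x using s(2) that unfolding bad_def by auto
  have same: "x = y" if "x \<in> R" "y \<in> R" "g x s = g y s" for x y
  proof (rule ccontr)
    assume "x \<noteq> y"
    then have "s \<in> (\<Union>x\<in>R. \<Union>y\<in>R - {x}. {s. x < s \<and> y < s \<and> g x s = g y s})"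
      using that less by (intro UN_I[of x] UN_I[of y]) simp_all
    then show False using s(2) unfolding bad_def by simp
  qed
  have old: "g x s \<noteq> g y t" if "x \<in> R" "y \<in> R" "t \<in> R" for x y t
  proof
    assume "g x s = g y t"
    then have "s \<in> (\<Union>x\<in>R. \<Union>y\<in>R. \<Union>t\<in>R. {s. x < s \<and> g x s = g y t})"
      using that less by (intro UN_I[of x] UN_I[of y] UN_I[of t]) simp_all
    then show False using s(2) unfolding bad_def by simp
  qed
  have "rainbow_for (chi A) (insert s R)"
    unfolding rainbow_for_def
  proof (intro ballI impI, elim conjE)
    fix x u y t
    assume in_R: "x \<in> insert s R" "u \<in> insert s R" "y \<in> insert s R" "t \<in> insert s R"
      and "x < u" "y < t" and eq: "g x u = g y t"
    \<comment> \<open>Since \<open>s\<close> lies above \<open>R\<close>, it can only be the upper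
      end of a pair.\<close>
    have "u \<le> s" "t \<le> s" using in_R less by (auto intro: less_imp_le)
    then have xy: "x \<in> R" "y \<in> R" using in_R \<open>x < u\<close> \<open>y < t\<close> by auto
    consider "u = s" "t = s" | "u = s" "t \<in> R" | "u \<in> R" "t = s" | "u \<in> R" "t \<in> R"
      using in_R by blast
    then show "x = y \<and> u = t"
    proof cases
      case 1
      then show ?thesis using same xy eq by blast
    next
      case 2
      then show ?thesis using old xy eq by blast
    next
      case 3
      then show ?thesis using old[of y x u] xy eq by simp
    next
      case 4
      then show ?thesis
        using assms(3) xy eq \<open>x < u\<close> \<open>y < t\<close> unfolding rainbow_for_def by blast
    qed
  qed
  then have "rainbow_next (join (chi A) G) R s" using less unfolding rainbow_next_def by simp
  then show ?thesis using s(1) by blast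
qed

abbreviation P :: orc where "P \<equiv> join (chi A) G"

definition a :: "nat \<Rightarrow> nat" where
  "a n = G (LEAST i. rainbow_next P (rainbow_stage P n) (G i))"

lemma rainbow_stage_Suc: "rainbow_stage P (Suc n) = insert (a n) (rainbow_stage P n)"
  by (simp add: a_def)

lemma rainbow_next_LeastI:
  assumes "finite (rainbow_stage P n) \<and> rainbow_stage P n \<subseteq> range G \<and> rainbow_for (chi A) (rainbow_stage P n)"
  shows "rainbow_next P (rainbow_stage P n) (a n)"
proof -
  have "\<exists>i. rainbow_next P (rainbow_stage P n) (G i)"
    by (rule ex_rainbow_next) (simp_all only: assms)
  then show ?thesis unfolding a_def by (rule LeastI_ex)
qed

lemma rainbow_stage_inv: "finite (rainbow_stage P n) \<and> rainbow_stage P n \<subseteq> range G \<and> rainbow_for (chi A) (rainbow_stage P n)"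
proof (induction n)
  case 0
  then show ?case by (simp add: rainbow_for_def)
next
  case (Suc n)
  have "rainbow_for (chi A) (insert (a n) (rainbow_stage P n))"
    using rainbow_next_LeastI[OF Suc] unfolding rainbow_next_def lft_join by (rule conjunct2)
  moreover have "a n \<in> range G" unfolding a_def by (rule rangeI)
  ultimately show ?case using Suc unfolding rainbow_stage_Suc by simp
qed

lemmas rainbow_next_a = rainbow_next_LeastI[OF rainbow_stage_inv]

lemma rainbow_stage_eq: "rainbow_stage P n = a ` {..<n}"
proof (induction n)
  case (Suc n)
  then show ?case unfolding rainbow_stage_Suc lessThan_Suc by simp
qed simp

lemma a_less: "m < n \<Longrightarrow> a m < a n"
  using conjunct1[OF rainbow_next_a[of n, unfolded rainbow_next_def rainbow_stage_eq]] by simp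

lemma a_ge: "n \<le> a n"
  by (rule strict_mono_imp_increasing) (simp add: strict_mono_def a_less)

lemma mem_range_a: "x \<in> range a \<longleftrightarrow> x \<in> rainbow_stage P (Suc x)"
  unfolding rainbow_stage_eq using a_ge by (force simp: less_Suc_eq_le)

lemma unbounded_range_a: "unbounded (range a)"
  unfolding unbounded_def
proof
  fix n
  have "n < a (Suc n)" using a_ge[of "Suc n"] by simp
  then show "\<exists>m>n. m \<in> range a" by blast
qed

lemma rainbow_range_a: "rainbow A (range a)"
  unfolding rainbow_def
proof (intro allI impI, elim conjE)
  fix x s y t c
  assume "x \<in> range a" "s \<in> range a" "x < s" "y \<in> range a" "t \<in> range a" "y < t"
    and c: "pr (pr x s) c \<in> A" "pr (pr y t) c \<in> A"
  then obtain i j k l where i: "x = a i" "s = a j" "y = a k" "t = a l" by blast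
  let ?n = "Suc (max (max i j) (max k l))"
  have "x \<in> rainbow_stage P ?n" "s \<in> rainbow_stage P ?n" "y \<in> rainbow_stage P ?n" "t \<in> rainbow_stage P ?n"
    unfolding rainbow_stage_eq i by auto
  moreover have "g x s = g y t" using c unfolding mem_iff by simp
  ultimately show "x = y \<and> s = t"
    using rainbow_stage_inv[of ?n] \<open>x < s\<close> \<open>y < t\<close> unfolding rainbow_for_def by blast
qed

lemma loc_rainbow_for:
  assumes "finite R"
  shows "loc (\<lambda>Q. rainbow_for Q R) (chi A)"
  unfolding rainbow_for_def
proof (intro loc_ball[OF assms])
  fix x s y t
  show "loc (\<lambda>Q. x < s \<and> y < t \<longrightarrow> colour Q x s = colour Q y t \<longrightarrow> x = y \<and> s = t) (chi A)"
    by (rule loc_imp[OF loc_const])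
      (rule loc_colours[where h = "\<lambda>c d. c = d \<longrightarrow> x = y \<and> s = t"], blast+)
qed

lemma loc_rainbow_stage: "loc (\<lambda>Q. rainbow_stage Q n) P"
proof (induction n)
  case 0
  then show ?case by (simp add: loc_const)
next
  case (Suc n)
  let ?R = "rainbow_stage P n"
  have nxt: "loc (\<lambda>Q. rainbow_next Q ?R b) P" for b
  proof -
    have "loc (\<lambda>Q. rainbow_for (lft Q) (insert b ?R)) P"
      by (rule loc_comp[OF cont_lft, where \<phi> = "\<lambda>Q. rainbow_for Q (insert b ?R)"])
        (use loc_rainbow_for rainbow_stage_inv in simp)
    then show ?thesis unfolding rainbow_next_def by (rule loc_conj[OF loc_const])
  qed
  have "loc (\<lambda>Q. rainbow_next Q ?R (rgt Q i)) P" for i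
    using loc_rgt nxt
    by (rule loc_bind[where \<phi> = "\<lambda>Q. rgt Q i" and \<psi> = "\<lambda>b Q. rainbow_next Q ?R b"])
  moreover obtain i where "rainbow_next P ?R (rgt P i)"
    using ex_rainbow_next[of ?R] rainbow_stage_inv[of n] by auto
  ultimately have "loc (\<lambda>Q. LEAST i. rainbow_next Q ?R (rgt Q i)) P"
    by (rule loc_Least[where \<psi> = "\<lambda>i Q. rainbow_next Q ?R (rgt Q i)", rotated])
  then have "loc (\<lambda>Q. rgt Q (LEAST i. rainbow_next Q ?R (rgt Q i))) P"
    by (rule loc_bind[where \<psi> = "\<lambda>i Q. rgt Q i"]) (rule loc_rgt)
  then have "loc (\<lambda>Q. insert (rgt Q (LEAST i. rainbow_next Q ?R (rgt Q i))) ?R) P"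
    by (rule loc_fun[where g = "\<lambda>b. insert b ?R"])
  with Suc have "loc (\<lambda>Q. insert (rgt Q (LEAST i. rainbow_next Q (rainbow_stage Q n) (rgt Q i))) (rainbow_stage Q n)) P"
    by (rule loc_bind[where \<psi> = "\<lambda>R Q. insert (rgt Q (LEAST i. rainbow_next Q R (rgt Q i))) R"])
  then show ?case by (simp only: rainbow_stage.simps)
qed

lemma red_range_a: "red (chi (range a)) P"
proof (rule redI[of _ ORain])
  show "chi (range a) = ev ORain P"
    by (simp add: chi_def rainbowF_def mem_range_a del: rainbow_stage.simps)
  have "loc (\<lambda>Q. rainbowF Q x) P" for x
    unfolding rainbowF_def by (rule loc_fun[OF loc_rainbow_stage, where g = "\<lambda>R. if x \<in> R then 1 else 0"])
  then show "cont (ev ORain) P" by (simp add: cont_def)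
qed

lemma ex_rainbow: "\<exists>R. unbounded R \<and> rainbow A R \<and> red (chi R) (join (chi A) G)"
  using unbounded_range_a rainbow_range_a red_range_a by blast

end

end

section \<open>Preserving lowness\<close>

lemma loc_ext: "loc (\<lambda>Q. map (join (rgt Q) (ext \<tau>)) [0..<k]) P"
proof (rule loc_map[where f = "\<lambda>Q. join (rgt Q) (ext \<tau>)"])
  show "loc (\<lambda>Q. join (rgt Q) (ext \<tau>) i) P" for i
    by (cases "even i") (simp_all add: join_def loc_rgt loc_const)
qed

lemma loc_forces: "loc (\<lambda>Q. forces Q q \<tau>) P"
proof (cases "from_nat q :: opterm \<times> nat")
  case (Pair t n)
  have "loc (\<lambda>Q. lft Q (to_nat (t, n, map (join (rgt Q) (ext \<tau>)) [0..<k])) = 1) P" for k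
  proof -
    have "loc (\<lambda>Q. lft Q (to_nat (t, n, map (join (rgt Q) (ext \<tau>)) [0..<k]))) P"
      using loc_ext by (rule loc_bind[where \<psi> = "\<lambda>l Q. lft Q (to_nat (t, n, l))"]) (rule loc_lft)
    then show ?thesis by (rule loc_fun[where g = "\<lambda>b. b = 1"])
  qed
  then show ?thesis unfolding forces_def Pair prod.case by (intro loc_ex_le)
qed

lemma cont_forcesF: "cont forcesF P"
  unfolding cont_def
proof
  fix i
  show "loc (\<lambda>Q. forcesF Q i) P"
  proof (cases "from_nat i :: nat \<times> nat list")
    case (Pair q \<tau>)
    show ?thesis unfolding forcesF_def Pair prod.case
      by (rule loc_fun[OF loc_forces, where g = "\<lambda>b. if b then 1 else 0"])
  qed
qed

lemma finite_codes: "finite {\<tau> :: nat list. to_nat \<tau> < t}"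
proof -
  have "{\<tau> :: nat list. to_nat \<tau> < t} = to_nat -` {..<t}" by auto
  then show ?thesis by (simp add: finite_vimageI)
qed

lemma cont_bigF: "cont bigF P"
  unfolding cont_def
proof
  fix i
  obtain n t :: nat where i: "from_nat i = (n, t)" by fastforce
  obtain k :: nat and E :: "nat list" and \<sigma> :: "nat list" where n: "from_nat n = (k, E, \<sigma>)"
    by (metis prod_cases3)
  have "loc (\<lambda>Q. {\<tau> \<in> {\<tau>. to_nat \<tau> < t}. \<exists>q\<in>set E. forces Q q \<tau>}) P"
    by (rule loc_Collect[OF finite_codes]) (rule loc_bex[OF finite_set], rule loc_forces)
  then have "loc (\<lambda>Q. if Big k {\<tau> \<in> {\<tau>. to_nat \<tau> < t}. \<exists>q\<in>set E. forces Q q \<tau>} \<sigma> then 1 else 0 :: nat) P"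
    by (rule loc_fun[where g = "\<lambda>B. if Big k B \<sigma> then 1 else 0"])
  then show "loc (\<lambda>Q. bigF Q i) P"
    unfolding bigF_def i n prod.case mem_Collect_eq .
qed

context weakly_stable_colouring
begin

context
  fixes X :: orc
  assumes low: "low X" and below: "red (chi A) X"
begin

text \<open>\<open>forces\<close> both consults the listing and reads \<open>X\<close>; as
  \<open>X\<close> is above \<open>listing\<close>, the join is still below
  \<open>X\<close>.\<close>

abbreviation H :: orc where "H \<equiv> join listing X"

lemma red_H: "red H X"
  using low red_refl unfolding low_def by (intro red_join) blast+

definition C :: "nat \<Rightarrow> nat list set" where
  "C q = {\<tau>. forces H q \<tau>}"

lemma map_ext:
  "k \<le> 2 * length \<tau> \<Longrightarrow> prefix \<tau> \<tau>' \<Longrightarrow>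
    map (join X (ext \<tau>)) [0..<k] = map (join X (ext \<tau>')) [0..<k]"
  by (auto simp: join_def ext_def prefix_def nth_append)

lemma C_mono:
  assumes "\<tau> \<in> C q" "prefix \<tau> \<tau>'"
  shows "\<tau>' \<in> C q"
proof -
  obtain t :: opterm and n :: nat where q: "from_nat q = (t, n)" by fastforce
  obtain k where k: "k \<le> 2 * length \<tau>" "listing (to_nat (t, n, map (join X (ext \<tau>)) [0..<k])) = 1"
    using assms(1) unfolding C_def forces_def mem_Collect_eq q by auto
  have "k \<le> 2 * length \<tau>'" using k(1) prefix_length_le[OF assms(2)] by simp
  then show ?thesis
    using k(2) unfolding C_def forces_def mem_Collect_eq q map_ext[OF k(1) assms(2)] by auto
qed

definition columns :: orc where
  "columns = join (sigm (bigF H)) (join (forcesF H) (simF S))"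

lemma bigF_iff: "sigm (bigF H) (to_nat (k, E, \<sigma>)) = 1 \<longleftrightarrow> Big k (\<Union>q\<in>set E. C q) \<sigma>"
proof -
  let ?B = "\<Union>q\<in>set E. C q"
  have "{\<tau>. to_nat \<tau> < t \<and> (\<exists>q\<in>set E. forces H q \<tau>)} = {\<tau>\<in>?B. to_nat \<tau> < t}" for t
    by (auto simp: C_def)
  then have "sigm (bigF H) (to_nat (k, E, \<sigma>)) = 1 \<longleftrightarrow> (\<exists>t. Big k {\<tau>\<in>?B. to_nat \<tau> < t} \<sigma>)"
    unfolding sigm_iff bigF_def by simp
  also have "\<dots> \<longleftrightarrow> Big k ?B \<sigma>"
    using Big_finite Big_mono[of k _ \<sigma> ?B] by blast
  finally show ?thesis .
qed

lemma bushy: "bushy columns C sim"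
proof
  show "isbig columns k E \<sigma> \<longleftrightarrow> Big k (\<Union>q\<in>set E. C q) \<sigma>" for k E \<sigma>
    unfolding isbig_def columns_def lft_join bigF_iff ..
  show "lft (rgt columns) (to_nat (q, \<tau>)) = 1 \<longleftrightarrow> \<tau> \<in> C q" for q \<tau>
    by (simp add: columns_def forcesF_def C_def)
  show "rgt (rgt columns) (to_nat (x, y)) = 1 \<longleftrightarrow> sim x y" for x y
    unfolding columns_def rgt_join simF_iff ..
qed (use C_mono sim_refl sim_card in blast)+

text \<open>Bigness is existential over \<open>X\<close> and costs one jump, forcing needs only
  \<open>X\<close>, and the equivalence is below the jump by weak stability. Lowness of
  \<open>X\<close> then brings everything below the jump of \<open>listing\<close>.\<close>

lemma red_columns: "red columns (jump listing)"
proof -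
  have J: "red (jump X) (jump listing)" using low unfolding low_def by blast
  have "red (bigF H) H" by (rule redI[of _ OBig]) (simp_all add: cont_bigF)
  then have "red (sigm (bigF H)) (jump X)" using red_trans[OF _ red_H] by (intro sigm_red_jump)
  moreover have "red (forcesF H) H" by (rule redI[of _ OIn]) (simp_all add: cont_forcesF)
  then have "red (forcesF H) (jump X)"
    by (intro red_jump_01) (use red_trans[OF _ red_H] in \<open>auto simp: forcesF_def split: prod.split\<close>)
  ultimately have "red columns (jump X)"
    unfolding columns_def using red_sim[OF below] by (intro red_join)
  then show ?thesis using J red_trans by blast
qed

interpretation bushy columns C sim by (rule bushy)

text \<open>The jump depends on finite parts of the join, each determined by \<open>X\<close> and an
  initial segment of \<open>G\<close>, and the construction has decided every such query in
  turn.\<close>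

lemma jump_join: "jump (join X G) = jumpF columns"
proof
  fix q
  obtain t :: opterm and n :: nat where q: "from_nat q = (t, n)" by fastforce
  have G: "map (join X (ext (map G [0..<m]))) [0..<k] = map (join X G) [0..<k]"
    if "k \<le> 2 * m" for k m
    using that by (auto simp: join_def ext_def)
  have forces: "forces H q (map G [0..<m]) \<longleftrightarrow>
      (\<exists>k\<le>2 * m. listing (to_nat (t, n, map (join X G) [0..<k])) = 1)" for m
    unfolding forces_def q prod.case lft_join rgt_join length_map length_upt minus_nat.diff_0
    using G by metis
  have "jump (join X G) q = 1 \<longleftrightarrow> (\<exists>k. listing (to_nat (t, n, map (join X G) [0..<k])) = 1)"
    unfolding jump_def q by simp
  \<comment> \<open>A part of length \<open>k\<close> of the join is covered by the first
    \<open>k\<close> entries of \<open>G\<close>.\<close>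
  also have "\<dots> \<longleftrightarrow> (\<exists>m. \<exists>k\<le>2 * m. listing (to_nat (t, n, map (join X G) [0..<k])) = 1)"
    by (metis le_add1 mult_2)
  also have "\<dots> \<longleftrightarrow> (\<exists>m. forces H q (map G [0..<m]))" unfolding forces ..
  also have "\<dots> \<longleftrightarrow> jumpF columns q = 1" unfolding jumpF_iff C_def by simp
  finally have "jump (join X G) q = 1 \<longleftrightarrow> jumpF columns q = 1" .
  then show "jump (join X G) q = jumpF columns q"
    using jump_01[of "join X G" q] by (auto simp: jumpF_def split: if_splits)
qed

lemma low_join: "low (join X G)"
  unfolding low_def
proof
  show "red listing (join X G)"
    using low red_trans[OF _ red_join_left] unfolding low_def by blast
  have "red (jumpF columns) columns" by (rule redI[of _ OCon]) (simp_all add: cont_jumpF)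
  then show "red (jump (join X G)) (jump listing)" unfolding jump_join using red_trans red_columns by blast
qed

lemma ex_low_rainbow:
  "\<exists>Y. low Y \<and> red X Y \<and> (\<exists>R. unbounded R \<and> rainbow A R \<and> red (chi R) Y)"
proof -
  have "red (join (chi A) G) (join X G)"
    using red_trans[OF below red_join_left] red_join_right by (rule red_join)
  then have "\<exists>R. unbounded R \<and> rainbow A R \<and> red (chi R) (join X G)"
    using ex_rainbow[of G, OF G_sim] red_trans by blast
  then show ?thesis using low_join red_join_left by blast
qed

end

end

section \<open>The model\<close>

definition instance_of :: "nat set \<Rightarrow> bool" where
  "instance_of A \<longleftrightarrow> colouring A \<and> bounded2 A \<and> weakly_stable A"

text \<open>Keeping \<open>X\<close> when the request is not a valid instance makes the tower total
  and increasing.\<close>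

definition solve :: "nat set \<Rightarrow> orc \<Rightarrow> orc" where
  "solve A X = (if instance_of A \<and> red (chi A) X
    then SOME Y. low Y \<and> red X Y \<and> (\<exists>R. unbounded R \<and> rainbow A R \<and> red (chi R) Y) else X)"

text \<open>Stage \<open>n\<close> decodes to a level and a functional, so every set of the model is
  treated at some stage. The \<open>min\<close> makes the recursion visibly well founded; the
  decoded level is at most \<open>n\<close> anyway.\<close>

fun tower :: "nat \<Rightarrow> orc" where
  "tower 0 = listing"
| "tower (Suc n) =
    solve {i. ev (from_nat (snd (prod_decode n))) (tower (min (fst (prod_decode n)) n)) i = 1} (tower n)"

lemma solve_instance:
  assumes "low X" "instance_of A" "red (chi A) X"
  shows "low (solve A X) \<and> red X (solve A X) \<and>
    (\<exists>R. unbounded R \<and> rainbow A R \<and> red (chi R) (solve A X))"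
proof -
  have "weakly_stable_colouring A"
    using assms(2) unfolding instance_of_def weakly_stable_colouring_def by blast
  then have "\<exists>Y. low Y \<and> red X Y \<and> (\<exists>R. unbounded R \<and> rainbow A R \<and> red (chi R) Y)"
    using assms(1,3) by (rule weakly_stable_colouring.ex_low_rainbow)
  from someI_ex[OF this] show ?thesis
    unfolding solve_def using assms(2,3) by (simp only: simp_thms if_True)
qed

lemma low_solve: "low X \<Longrightarrow> low (solve A X) \<and> red X (solve A X)"
  using solve_instance[of X A] red_refl by (cases "instance_of A \<and> red (chi A) X") (auto simp: solve_def)

lemma low_tower: "low (tower n)"
  by (induction n) (simp_all add: low_listing low_solve)

lemma tower_mono: "m \<le> n \<Longrightarrow> red (tower m) (tower n)"
proof (induction rule: dec_induct)
  case base
  then show ?case by (rule red_refl)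
next
  case (step n)
  have "red (tower n) (tower (Suc n))" using low_solve[OF low_tower[of n]] by simp
  with step show ?case using red_trans by blast
qed

lemma ideal_tower: "ideal (range tower)"
  unfolding ideal_def using tower_mono by (metis (no_types) UNIV_I empty_iff image_iff nat_le_linear range_eqI red_refl)

abbreviation model :: "nat set set" where
  "model \<equiv> sets_below (range tower)"

lemma model_rainbow:
  assumes "A \<in> model" "instance_of A"
  shows "\<exists>R\<in>model. unbounded R \<and> rainbow A R"
proof -
  obtain m where "red (chi A) (tower m)" using assms(1) unfolding sets_below_def by blast
  then obtain t where t: "chi A = ev t (tower m)" and red: "red (chi A) (tower m)"
    unfolding red_def by blast
  let ?n = "prod_encode (m, to_nat t)"
  have m: "m \<le> ?n" by (rule le_prod_encode_1)
  have "{i. ev t (tower m) i = 1} = A" by (simp flip: t)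
  then have suc: "tower (Suc ?n) = solve A (tower ?n)" using m by simp
  have "red (chi A) (tower ?n)" using red tower_mono[OF m] red_trans by blast
  then obtain R where "unbounded R" "rainbow A R" "red (chi R) (tower (Suc ?n))"
    using solve_instance[OF low_tower assms(2)] unfolding suc by blast
  then show ?thesis unfolding sets_below_def by blast
qed

text \<open>Characteristic functions are 0-1 valued, hence below the jump of their oracle, and
  lowness moves this jump down.\<close>

lemma model_low:
  assumes "A \<in> model"
  shows "red (chi A) (jump listing)"
proof -
  obtain n where "red (chi A) (tower n)" using assms unfolding sets_below_def by blast
  then have "red (chi A) (jump (tower n))" by (rule red_jump_01) (simp add: chi_def)
  then show ?thesis using low_tower[of n] red_trans unfolding low_def by blast
qed

lemma diag_model: "diag \<in> model"
proof -
  have "listing \<in> range tower" by (metis rangeI tower.simps(1))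
  then show ?thesis unfolding sets_below_def using red_diag by blast
qed

section \<open>Evaluation of the formulas in the model\<close>

lemma tval_pair [simp]: "tval v (pair s t) = pr (tval v s) (tval v t)"
  by (simp add: pair_def pr_def)

lemmas sat_expand = Let_def foldr_Cons foldr_Nil o_apply id_apply sat.simps tval.simps tval_pair
  fun_upd_apply list.inject char.inject simp_thms if_True if_False

text \<open>The connectives of \<open>fm\<close> are encoded by implication and falsity; bringing
  both readings to a common form by de Morgan laws makes them coincide.\<close>

lemmas normal_form = Ball_def imp_conv_disj de_Morgan_conj de_Morgan_disj not_not not_all not_ex
  conj_assoc disj_assoc simp_thms

lemma sat_colouring: "sat M v E (is_colouring F) \<longleftrightarrow> colouring (E F)"
  unfolding is_colouring_def value_is_def colouring_def
  by (simp only: sat_expand) (simp only: normal_form)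

lemma sat_2_bounded: "sat M v E (is_2_bounded F) \<longleftrightarrow> bounded2 (E F)"
  unfolding is_2_bounded_def value_is_def bounded2_def
  by (simp only: sat_expand) (simp only: normal_form)

lemma sat_infinite: "sat M v E (is_infinite R) \<longleftrightarrow> unbounded (E R)"
  by (simp add: is_infinite_def unbounded_def Let_def)

lemma sat_rainbow: "sat M v E (is_rainbow F R) \<longleftrightarrow> rainbow (E F) (E R)"
  unfolding is_rainbow_def value_is_def rainbow_def
  by (simp only: sat_expand) (simp only: normal_form)

lemma sat_weakly_stable: "sat M v E (is_weakly_rainbow_stable F) \<longleftrightarrow> weakly_stable (E F)"
  unfolding is_weakly_rainbow_stable_def value_is_def weakly_stable_def
  by (simp only: sat_expand) (simp only: normal_form)

lemma sat_RRT22: "sat M v E RRT22 \<longleftrightarrow>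
    (\<forall>A\<in>M. colouring A \<and> bounded2 A \<longrightarrow> (\<exists>R\<in>M. unbounded R \<and> rainbow A R))"
  by (simp add: RRT22_def sat_colouring sat_2_bounded sat_infinite sat_rainbow)

lemma sat_WSRRT22: "sat M v E WSRRT22 \<longleftrightarrow>
    (\<forall>A\<in>M. instance_of A \<longrightarrow> (\<exists>R\<in>M. unbounded R \<and> rainbow A R))"
  by (simp add: WSRRT22_def instance_of_def sat_colouring sat_2_bounded sat_weakly_stable
      sat_infinite sat_rainbow)

theorem corollary6p11:
  shows "\<not> RCA0 \<turnstile> (WSRRT22 \<^bold>\<rightarrow> RRT22)"
proof
  assume "RCA0 \<turnstile> (WSRRT22 \<^bold>\<rightarrow> RRT22)"
  \<comment> \<open>Both statements are sentences, so the assignment only has to take values in the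
    model, and \<open>diag\<close> is at hand.\<close>
  then have "sat model (\<lambda>_. 0) (\<lambda>_. diag) (WSRRT22 \<^bold>\<rightarrow> RRT22)"
    by (rule soundness[where M = model]) (use sat_RCA0[OF ideal_tower] diag_model in blast)+
  then have "\<forall>A\<in>model. colouring A \<and> bounded2 A \<longrightarrow> (\<exists>R\<in>model. unbounded R \<and> rainbow A R)"
    using model_rainbow by (simp only: sat.simps sat_RRT22 sat_WSRRT22) blast
  then obtain R where "R \<in> model" "unbounded R" "rainbow diag R"
    using diag_model colouring_diag bounded2_diag by blast
  then show False using no_rainbow_diag model_low by blast
qed

end
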